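(* In the setting described in the context, suppose the gapless condition (C) holds for every $v\in V$, and let $x^1,\dots,x^N$ be a non-excessive route. Then: (i) any rotation occurs in this route at most once; and (ii) $N<4|E|^2|F||W|$.
   Context: Let $G=(V,E)$ be a finite bipartite graph with color classes $W$ and $F$; the edge joining $w\in W$ and $f\in F$ is written $wf$. Let $b\in\mathbb Z_+^E$ be capacities. For $v\in V$, $E_v$ is the set of edges at $v$, $\mathcal B_v=\{z\in\mathbb Z_+^{E_v}: z\le b|_{E_v}\}$, $\mathbf 1^e$ the unit vector of $e$, $|z|=\sum_e|z(e)|$, $\wedge,\vee$ componentwise min/max. Each $v$ has a choice function $C_v:\mathcal B_v\to\mathcal B_v$ with $C_v(z)\le z$ and, for all $z,z'$: (A1) $z\ge z'\ge C_v(z)\Rightarrow C_v(z')=C_v(z)$; (A2) $z\ge z'\Rightarrow C_v(z)\wedge z'\le C_v(z')$; (A3) $z\ge z'\Rightarrow|C_v(z)|\ge|C_v(z')|$. $z$ is acceptable if $C_v(z)=z$; for distinct acceptable $z,z'$, $z'\prec_v z$ iff $C_v(z\vee z')=z$. $x_v$ = restriction of $x$ to $E_v$. A g-matching is $x\in\mathbb Z_+^E$, $x\le b$, each $x_v$ acceptable; $x\prec_F y$ (distinct) iff $x_f\preceq_f y_f$ for all $f\in F$. $e\in E_v$ is interesting for $v$ under acceptable $z$ if some $z'\in\mathcal B_v$ has $z'(e)>z(e)$, $z'(e')=z(e')$ for $e'\neq e$, $C_v(z')(e)>z(e)$; $e=wf$ blocks a g-matching $x$ if it is interesting for $w$ under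 $x_w$ and for $f$ under $x_f$; $\mathcal S$ = stable g-matchings (no blocking edges), a nonempty finite distributive lattice under $\prec_F$ with minimum $x^{\min}$, maximum $x^{\max}$. Rotations: for $x\in\mathcal S$, $U_F^+(x)$ = edges $wf$ interesting for $f$ under $x_f$; $U_F^-(x)$ = edges $wf$ with $x(wf)>0$ not interesting for $f$ under $x_f$. Legal $f$-pair: $(a,c)$, $a\in U_F^+(x)\cap E_f$, $c\in E_f\setminus\{a\}$, $C_f(x_f+\mathbf 1^a)=x_f+\mathbf 1^a-\mathbf 1^c$. Legal $w$-pair: $(c,a)$, $c\in U_F^-(x)\cap E_w$, $a\in U_F^+(x)\cap E_w$, $x_w+\mathbf 1^a-\mathbf 1^c$ acceptable; essential if no $d\in (U_F^+(x)\cap E_w)\setminus\{a\}$ is interesting for $w$ under $x_w+\mathbf 1^a-\mathbf 1^c$. Form a digraph with vertices $w^e,f^e$ for $e=wf\in U_F^+(x)\cup U_F^-(x)$ and arcs $(w^a,f^a)$ for $a\in U_F^+(x)$, $(f^c,w^c)$ for $c\in U_F^-(x)$, $(f^a,f^c)$ for legal $f$-pairs $(a,c)$, $(w^c,w^a)$ for essential $w$-pairs $(c,a)$; repeatedly delete vertices with no entering arc; each remaining directed cycle gives a cyclic sequence $(a_1,c_1,\dots,a_k,c_k)$ of distinct edges of $G$, a rotation $R$ applicable to $x$ ($R\in\mathcal R(x)$), with $\chi^R$ equal to $1$ on the $a_i$, $-1$ on the $c_i$, $0$ otherwise. Two rotations are the same if they are the same cyclic edge sequence. For $R\in\mathcal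 R(x)$, $\lambda\in\mathbb Z_{>0}$ is a feasible weight if $x+i\chi^R\in\mathcal S$ for $i=1,\dots,\lambda$; $\tau_R(x)$ is the maximum feasible weight. A route is a sequence $x^1,\dots,x^N$ of stable g-matchings with $x^{i+1}=x^i+\lambda_i\chi^{R_i}$, $R_i\in\mathcal R(x^i)$, $\lambda_i$ feasible for $R_i$ at $x^i$; it is non-excessive if $i<j$ and $R_i=R_j$ imply $\lambda_i=\tau_{R_i}(x^i)$. Gapless condition (C) for $v\in V$: if acceptable $z^1,z^2,z^3\in\mathcal B_v$ and edges $a,c^1,c^2,c^3\in E_v$ satisfy (i) $z^1\prec_v z^2\prec_v z^3$, (ii) $C_v(z^i+\mathbf 1^a)=z^i+\mathbf 1^a-\mathbf 1^{c^i}$ for $i=1,2,3$, and (iii) $c^1=c^3$, then $c^1=c^2$.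
   Formalization: The edge set E is assumed nonempty; if E is empty, the one-term route x^1 = 0 is non-excessive and the bound in (ii) would read 1 < 0, so the claim fails there. *)

theory Defs
  imports Main "HOL-Library.Function_Algebras"
begin

record ('w,'f) market =
  Wset :: "'w set"
  Fset :: "'f set"
  Eset :: "('w \<times> 'f) set"
  cap  :: "('w \<times> 'f) \<Rightarrow> int"
  CW   :: "'w \<Rightarrow> (('w \<times> 'f) \<Rightarrow> int) \<Rightarrow> (('w \<times> 'f) \<Rightarrow> int)"
  CF   :: "'f \<Rightarrow> (('w \<times> 'f) \<Rightarrow> int) \<Rightarrow> (('w \<times> 'f) \<Rightarrow> int)"

definition Bv :: "('e \<Rightarrow> int) \<Rightarrow> 'e set \<Rightarrow> ('e \<Rightarrow> int) set" where
  "Bv b S = {z. (\<forall>e. e \<notin> S \<longrightarrow> z e = 0) \<and> (\<forall>e\<in>S. 0 \<le> z e \<and> z e \<le> b e)}"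

definition absv :: "'e set \<Rightarrow> ('e \<Rightarrow> int) \<Rightarrow> int" where
  "absv S z = (\<Sum>e\<in>S. \<bar>z e\<bar>)"

definition choice_fn :: "('e \<Rightarrow> int) \<Rightarrow> 'e set \<Rightarrow> (('e \<Rightarrow> int) \<Rightarrow> ('e \<Rightarrow> int)) \<Rightarrow> bool" where
  "choice_fn b S C \<longleftrightarrow>
     (\<forall>z\<in>Bv b S. C z \<in> Bv b S \<and> C z \<le> z) \<and>
     (\<forall>z\<in>Bv b S. \<forall>z'\<in>Bv b S. z \<ge> z' \<and> z' \<ge> C z \<longrightarrow> C z' = C z) \<and>
     (\<forall>z\<in>Bv b S. \<forall>z'\<in>Bv b S. z \<ge> z' \<longrightarrow> inf (C z) z' \<le> C z') \<and>
     (\<forall>z\<in>Bv b S. \<forall>z'\<in>Bv b S. z \<ge> z' \<longrightarrow> absv S (C z) \<ge> absv S (C z'))"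

definition acceptable :: "('e \<Rightarrow> int) \<Rightarrow> 'e set \<Rightarrow> (('e \<Rightarrow> int) \<Rightarrow> ('e \<Rightarrow> int)) \<Rightarrow> ('e \<Rightarrow> int) \<Rightarrow> bool" where
  "acceptable b S C z \<longleftrightarrow> z \<in> Bv b S \<and> C z = z"

definition prefv :: "('e \<Rightarrow> int) \<Rightarrow> 'e set \<Rightarrow> (('e \<Rightarrow> int) \<Rightarrow> ('e \<Rightarrow> int)) \<Rightarrow> ('e \<Rightarrow> int) \<Rightarrow> ('e \<Rightarrow> int) \<Rightarrow> bool" where
  "prefv b S C z' z \<longleftrightarrow> acceptable b S C z \<and> acceptable b S C z' \<and> z \<noteq> z' \<and> C (sup z z') = z"

definition unitv :: "'e \<Rightarrow> 'e \<Rightarrow> int" where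
  "unitv e = (\<lambda>e'. if e' = e then 1 else 0)"

definition interesting :: "('e \<Rightarrow> int) \<Rightarrow> 'e set \<Rightarrow> (('e \<Rightarrow> int) \<Rightarrow> ('e \<Rightarrow> int)) \<Rightarrow> ('e \<Rightarrow> int) \<Rightarrow> 'e \<Rightarrow> bool" where
  "interesting b S C z e \<longleftrightarrow> e \<in> S \<and>
     (\<exists>z'\<in>Bv b S. z' e > z e \<and> (\<forall>e'. e' \<noteq> e \<longrightarrow> z' e' = z e') \<and> C z' e > z e)"

definition gapless :: "('e \<Rightarrow> int) \<Rightarrow> 'e set \<Rightarrow> (('e \<Rightarrow> int) \<Rightarrow> ('e \<Rightarrow> int)) \<Rightarrow> bool" where
  "gapless b S C \<longleftrightarrow>
    (\<forall>z1 z2 z3 a c1 c2 c3.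
       acceptable b S C z1 \<and> acceptable b S C z2 \<and> acceptable b S C z3 \<and>
       a \<in> S \<and> c1 \<in> S \<and> c2 \<in> S \<and> c3 \<in> S \<and>
       prefv b S C z1 z2 \<and> prefv b S C z2 z3 \<and>
       z1 + unitv a \<in> Bv b S \<and> z2 + unitv a \<in> Bv b S \<and> z3 + unitv a \<in> Bv b S \<and>
       C (z1 + unitv a) = z1 + unitv a - unitv c1 \<and>
       C (z2 + unitv a) = z2 + unitv a - unitv c2 \<and>
       C (z3 + unitv a) = z3 + unitv a - unitv c3 \<and>
       c1 = c3 \<longrightarrow> c1 = c2)"

definition Ew :: "('w,'f) market \<Rightarrow> 'w \<Rightarrow> ('w \<times> 'f) set" where
  "Ew G w = {e \<in> Eset G. fst e = w}"

definition Ef :: "('w,'f) market \<Rightarrow> 'f \<Rightarrow> ('w \<times> 'f) set" where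
  "Ef G f = {e \<in> Eset G. snd e = f}"

definition rs :: "'e set \<Rightarrow> ('e \<Rightarrow> int) \<Rightarrow> ('e \<Rightarrow> int)" where
  "rs S x = (\<lambda>e. if e \<in> S then x e else 0)"

definition wf_market :: "('w,'f) market \<Rightarrow> bool" where
  "wf_market G \<longleftrightarrow> finite (Wset G) \<and> finite (Fset G) \<and> Eset G \<subseteq> Wset G \<times> Fset G \<and>
     (\<forall>e\<in>Eset G. cap G e \<ge> 0) \<and>
     (\<forall>w\<in>Wset G. choice_fn (cap G) (Ew G w) (CW G w)) \<and>
     (\<forall>f\<in>Fset G. choice_fn (cap G) (Ef G f) (CF G f))"

definition all_gapless :: "('w,'f) market \<Rightarrow> bool" where
  "all_gapless G \<longleftrightarrow>
     (\<forall>w\<in>Wset G. gapless (cap G) (Ew G w) (CW G w)) \<and>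
     (\<forall>f\<in>Fset G. gapless (cap G) (Ef G f) (CF G f))"

definition gmatching :: "('w,'f) market \<Rightarrow> (('w \<times> 'f) \<Rightarrow> int) \<Rightarrow> bool" where
  "gmatching G x \<longleftrightarrow>
     (\<forall>e. e \<notin> Eset G \<longrightarrow> x e = 0) \<and> (\<forall>e\<in>Eset G. 0 \<le> x e \<and> x e \<le> cap G e) \<and>
     (\<forall>w\<in>Wset G. acceptable (cap G) (Ew G w) (CW G w) (rs (Ew G w) x)) \<and>
     (\<forall>f\<in>Fset G. acceptable (cap G) (Ef G f) (CF G f) (rs (Ef G f) x))"

definition intW :: "('w,'f) market \<Rightarrow> (('w \<times> 'f) \<Rightarrow> int) \<Rightarrow> ('w \<times> 'f) \<Rightarrow> bool" where
  "intW G z e = interesting (cap G) (Ew G (fst e)) (CW G (fst e)) z e"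

definition intF :: "('w,'f) market \<Rightarrow> (('w \<times> 'f) \<Rightarrow> int) \<Rightarrow> ('w \<times> 'f) \<Rightarrow> bool" where
  "intF G z e = interesting (cap G) (Ef G (snd e)) (CF G (snd e)) z e"

definition blocks :: "('w,'f) market \<Rightarrow> (('w \<times> 'f) \<Rightarrow> int) \<Rightarrow> ('w \<times> 'f) \<Rightarrow> bool" where
  "blocks G x e \<longleftrightarrow> e \<in> Eset G \<and>
     intW G (rs (Ew G (fst e)) x) e \<and> intF G (rs (Ef G (snd e)) x) e"

definition stable :: "('w,'f) market \<Rightarrow> (('w \<times> 'f) \<Rightarrow> int) \<Rightarrow> bool" where
  "stable G x \<longleftrightarrow> gmatching G x \<and> (\<forall>e\<in>Eset G. \<not> blocks G x e)"

definition Uplus :: "('w,'f) market \<Rightarrow> (('w \<times> 'f) \<Rightarrow> int) \<Rightarrow> ('w \<times> 'f) set" where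
  "Uplus G x = {e \<in> Eset G. intF G (rs (Ef G (snd e)) x) e}"

definition Uminus :: "('w,'f) market \<Rightarrow> (('w \<times> 'f) \<Rightarrow> int) \<Rightarrow> ('w \<times> 'f) set" where
  "Uminus G x = {e \<in> Eset G. x e > 0 \<and> \<not> intF G (rs (Ef G (snd e)) x) e}"

definition legal_f :: "('w,'f) market \<Rightarrow> (('w \<times> 'f) \<Rightarrow> int) \<Rightarrow> ('w \<times> 'f) \<Rightarrow> ('w \<times> 'f) \<Rightarrow> bool" where
  "legal_f G x a c \<longleftrightarrow> a \<in> Uplus G x \<and> c \<in> Ef G (snd a) - {a} \<and>
     CF G (snd a) (rs (Ef G (snd a)) x + unitv a) = rs (Ef G (snd a)) x + unitv a - unitv c"

definition legal_w :: "('w,'f) market \<Rightarrow> (('w \<times> 'f) \<Rightarrow> int) \<Rightarrow> ('w \<times> 'f) \<Rightarrow> ('w \<times> 'f) \<Rightarrow> bool" where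
  "legal_w G x c a \<longleftrightarrow> c \<in> Uminus G x \<and> a \<in> Uplus G x \<and> fst a = fst c \<and>
     acceptable (cap G) (Ew G (fst c)) (CW G (fst c)) (rs (Ew G (fst c)) x + unitv a - unitv c)"

definition essential_w :: "('w,'f) market \<Rightarrow> (('w \<times> 'f) \<Rightarrow> int) \<Rightarrow> ('w \<times> 'f) \<Rightarrow> ('w \<times> 'f) \<Rightarrow> bool" where
  "essential_w G x c a \<longleftrightarrow> legal_w G x c a \<and>
     \<not> (\<exists>d \<in> (Uplus G x \<inter> Ew G (fst c)) - {a}.
          interesting (cap G) (Ew G (fst c)) (CW G (fst c)) (rs (Ew G (fst c)) x + unitv a - unitv c) d)"

datatype 'e node = WN 'e | FN 'e

definition nodes :: "('w,'f) market \<Rightarrow> (('w \<times> 'f) \<Rightarrow> int) \<Rightarrow> ('w \<times> 'f) node set" where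
  "nodes G x = WN ` (Uplus G x \<union> Uminus G x) \<union> FN ` (Uplus G x \<union> Uminus G x)"

definition arc :: "('w,'f) market \<Rightarrow> (('w \<times> 'f) \<Rightarrow> int) \<Rightarrow> ('w \<times> 'f) node \<Rightarrow> ('w \<times> 'f) node \<Rightarrow> bool" where
  "arc G x u v \<longleftrightarrow> u \<in> nodes G x \<and> v \<in> nodes G x \<and>
     ((\<exists>a\<in>Uplus G x. u = WN a \<and> v = FN a) \<or>
      (\<exists>c\<in>Uminus G x. u = FN c \<and> v = WN c) \<or>
      (\<exists>a c. legal_f G x a c \<and> u = FN a \<and> v = FN c) \<or>
      (\<exists>c a. essential_w G x c a \<and> u = WN c \<and> v = WN a))"

text \<open>The vertex set remaining after repeatedly deleting vertices without entering arc:
  the largest set of vertices in which every vertex has an entering arc from the set.\<close>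
definition core :: "('w,'f) market \<Rightarrow> (('w \<times> 'f) \<Rightarrow> int) \<Rightarrow> ('w \<times> 'f) node set" where
  "core G x = \<Union>{X. X \<subseteq> nodes G x \<and> (\<forall>v\<in>X. \<exists>u\<in>X. arc G x u v)}"

text \<open>A rotation is represented by the list of pairs [(a1,c1),...,(ak,ck)], i.e. the
  cyclic edge sequence (a1,c1,...,ak,ck), arising from the directed cycle
  w^a1 -> f^a1 -> f^c1 -> w^c1 -> w^a2 -> ... -> w^ck -> w^a1 of the reduced digraph.\<close>
definition rotation_of :: "('w,'f) market \<Rightarrow> (('w \<times> 'f) \<Rightarrow> int) \<Rightarrow> (('w \<times> 'f) \<times> ('w \<times> 'f)) list \<Rightarrow> bool" where
  "rotation_of G x R \<longleftrightarrow> R \<noteq> [] \<and> distinct (concat (map (\<lambda>(a,c). [a,c]) R)) \<and>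
     (\<forall>i<length R.
        let a = fst (R ! i); c = snd (R ! i); a' = fst (R ! ((i + 1) mod length R)) in
        WN a \<in> core G x \<and> FN a \<in> core G x \<and> FN c \<in> core G x \<and> WN c \<in> core G x \<and>
        arc G x (WN a) (FN a) \<and> arc G x (FN a) (FN c) \<and> arc G x (FN c) (WN c) \<and>
        arc G x (WN c) (WN a'))"

definition same_rot :: "('e \<times> 'e) list \<Rightarrow> ('e \<times> 'e) list \<Rightarrow> bool" where
  "same_rot R R' \<longleftrightarrow> (\<exists>n. rotate n R = R')"

definition chi :: "('e \<times> 'e) list \<Rightarrow> 'e \<Rightarrow> int" where
  "chi R e = (if e \<in> fst ` set R then 1 else if e \<in> snd ` set R then -1 else 0)"

definition addrot :: "('e \<Rightarrow> int) \<Rightarrow> nat \<Rightarrow> ('e \<times> 'e) list \<Rightarrow> ('e \<Rightarrow> int)" where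
  "addrot x l R = (\<lambda>e. x e + int l * chi R e)"

definition feasible_weight :: "('w,'f) market \<Rightarrow> (('w \<times> 'f) \<Rightarrow> int) \<Rightarrow> (('w \<times> 'f) \<times> ('w \<times> 'f)) list \<Rightarrow> nat \<Rightarrow> bool" where
  "feasible_weight G x R l \<longleftrightarrow> l > 0 \<and> (\<forall>i\<in>{1..l}. stable G (addrot x i R))"

definition tau :: "('w,'f) market \<Rightarrow> (('w \<times> 'f) \<Rightarrow> int) \<Rightarrow> (('w \<times> 'f) \<times> ('w \<times> 'f)) list \<Rightarrow> nat" where
  "tau G x R = (GREATEST l. feasible_weight G x R l)"

definition route :: "('w,'f) market \<Rightarrow> nat \<Rightarrow> (nat \<Rightarrow> (('w \<times> 'f) \<Rightarrow> int)) \<Rightarrow>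
    (nat \<Rightarrow> (('w \<times> 'f) \<times> ('w \<times> 'f)) list) \<Rightarrow> (nat \<Rightarrow> nat) \<Rightarrow> bool" where
  "route G N xs Rs lam \<longleftrightarrow> N \<ge> 1 \<and> (\<forall>i\<in>{1..N}. stable G (xs i)) \<and>
     (\<forall>i. 1 \<le> i \<and> i < N \<longrightarrow>
        rotation_of G (xs i) (Rs i) \<and> feasible_weight G (xs i) (Rs i) (lam i) \<and>
        xs (Suc i) = addrot (xs i) (lam i) (Rs i))"

definition non_excessive :: "('w,'f) market \<Rightarrow> nat \<Rightarrow> (nat \<Rightarrow> (('w \<times> 'f) \<Rightarrow> int)) \<Rightarrow>
    (nat \<Rightarrow> (('w \<times> 'f) \<times> ('w \<times> 'f)) list) \<Rightarrow> (nat \<Rightarrow> nat) \<Rightarrow> bool" where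
  "non_excessive G N xs Rs lam \<longleftrightarrow> route G N xs Rs lam \<and>
     (\<forall>i j. 1 \<le> i \<and> i < j \<and> j < N \<and> same_rot (Rs i) (Rs j) \<longrightarrow> lam i = tau G (xs i) (Rs i))"

end

theory Submission
  imports Defs
begin

text \<open>
Moving along a route, the edges that interest their firm shrink as a set; on this set values only
increase and off it they only decrease. Hence each edge evolves unimodally. For an agent, the
acceptable vectors are ordered by inclusion of the largest vectors from which they are chosen,
and gaplessness becomes convexity: a legal \<open>f\<close>-pair or essential \<open>w\<close>-pair present at two members
of a route is present at all members in between.

A rotation occurring at \<open>x\<^sup>i\<close> and again at \<open>x\<^sup>j\<close> would therefore still be a cycle at \<open>x\<^sup>i\<^sup>+\<^sup>1\<close>, hence
could be shifted once more, contradicting the maximality of the weight used at \<open>x\<^sup>i\<close>. For the bound,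
at any stable \<open>x\<close> an edge has at most one successor, so a cycle is determined by any of its arcs.
Mapping a rotation to an arc of it that becomes active last is thus injective, and there are at
most \<open>2|E|\<^sup>2\<close> possible arcs.
\<close>

section \<open>A single choice function\<close>

lemma unitv_inject: "unitv c = unitv c' \<Longrightarrow> c = c'"
  by (metis unitv_def zero_neq_one)

locale choice_function =
  fixes b :: "'e \<Rightarrow> int" and S :: "'e set" and C :: "('e \<Rightarrow> int) \<Rightarrow> ('e \<Rightarrow> int)"
  assumes finite_S: "finite S" and choice: "choice_fn b S C"
begin

abbreviation "B \<equiv> Bv b S"
abbreviation "acc \<equiv> acceptable b S C"
abbreviation "intr \<equiv> interesting b S C"

section \<open>Elementary consequences of the choice axioms\<close>

lemma C_in_B [simp]: "z \<in> B \<Longrightarrow> C z \<in> B"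
  using choice unfolding choice_fn_def by blast

lemma C_le: "z \<in> B \<Longrightarrow> C z e \<le> z e"
  using choice unfolding choice_fn_def le_fun_def by blast

lemma consistent: "\<lbrakk>z \<in> B; z' \<in> B; z' \<le> z; C z \<le> z'\<rbrakk> \<Longrightarrow> C z' = C z"
  using choice unfolding choice_fn_def by blast

lemma substitutable:
  assumes "z \<in> B" "z' \<in> B" "z' \<le> z"
  shows "min (C z e) (z' e) \<le> C z' e"
proof -
  have "inf (C z) z' \<le> C z'"
    using choice assms unfolding choice_fn_def by blast
  then show ?thesis by (simp add: le_fun_def inf_min)
qed

lemma absv_eq_sum: "z \<in> B \<Longrightarrow> absv S z = sum z S"
  unfolding absv_def Bv_def by (intro sum.cong) auto

lemma size_mono:
  assumes "z \<in> B" "z' \<in> B" "z' \<le> z"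
  shows "sum (C z') S \<le> sum (C z) S"
proof -
  have "absv S (C z') \<le> absv S (C z)"
    using choice assms unfolding choice_fn_def by blast
  then show ?thesis using assms by (simp add: absv_eq_sum)
qed

lemma B_outside: "z \<in> B \<Longrightarrow> e \<notin> S \<Longrightarrow> z e = 0"
  by (auto simp: Bv_def)

lemma B_between: "\<lbrakk>u \<in> B; v \<in> B; u \<le> z; z \<le> v\<rbrakk> \<Longrightarrow> z \<in> B"
  by (simp add: Bv_def le_fun_def) (metis order_antisym order_trans)

lemma acc_C: "z \<in> B \<Longrightarrow> acc (C z)"
  using consistent[of z "C z"] by (auto simp: acceptable_def le_fun_def C_le)

lemma acc_in_B [simp]: "acc z \<Longrightarrow> z \<in> B"
  by (simp add: acceptable_def)

lemma acc_eq: "acc z \<Longrightarrow> C z = z"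
  by (simp add: acceptable_def)

lemma sup_in_B: "u \<in> B \<Longrightarrow> v \<in> B \<Longrightarrow> sup u v \<in> B"
  by (auto simp: Bv_def sup_max)

section \<open>Totals and single units\<close>

lemma sum_unitv: "a \<in> S \<Longrightarrow> sum (unitv a) S = 1"
  using finite_S by (simp add: unitv_def sum.delta)

lemma sum_add_unitv: "a \<in> S \<Longrightarrow> sum (z + unitv a) S = sum z S + 1"
  using sum_unitv[of a] by (simp add: sum.distrib)

lemma sum_diff_unitv: "a \<in> S \<Longrightarrow> sum (z - unitv a) S = sum z S - 1"
  using sum_unitv[of a] by (simp add: sum_subtractf)

lemma eq_if_sum_le:
  assumes "u \<in> B" "v \<in> B" "u \<le> v" "sum v S \<le> sum u S"
  shows "u = v"
proof
  fix e
  have "sum (\<lambda>e. v e - u e) S = 0"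
    using assms sum_mono[of S u v] by (simp add: sum_subtractf le_fun_def)
  then have "\<forall>e\<in>S. v e - u e = 0"
    using finite_S assms by (subst (asm) sum_nonneg_eq_0_iff) (auto simp: le_fun_def)
  then show "u e = v e"
    using assms by (cases "e \<in> S") (auto simp: B_outside)
qed

text \<open>Turns the inequalities supplied by size monotonicity into exact information: integrality
  leaves room for at most one unit, hence for a single changed coordinate.\<close>

lemma eq_or_add_unitv:
  assumes "u \<in> B" "v \<in> B" "u \<le> v" "sum v S \<le> sum u S + 1"
  obtains "v = u" | a where "a \<in> S" "v = u + unitv a"
proof (cases "v = u")
  case False
  then obtain a where a: "u a \<noteq> v a" by (metis ext)
  have aS: "a \<in> S" using a assms by (metis B_outside)
  have le: "u + unitv a \<le> v"
  proof (rule le_funI)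
    fix e show "(u + unitv a) e \<le> v e"
      using a le_funD[OF assms(3), of e] by (auto simp: unitv_def)
  qed
  have "u + unitv a \<in> B"
    by (rule B_between[OF assms(1,2) _ le]) (auto simp: le_fun_def unitv_def)
  then have "u + unitv a = v"
    using eq_if_sum_le[OF _ assms(2) le] assms(4) aS by (simp only: sum_add_unitv)
  then show ?thesis using aS that by blast
qed (use that in blast)

section \<open>Interesting edges and closures of acceptable vectors\<close>

lemma interestingI:
  assumes "z \<in> B" "y \<in> B" "z \<le> y" "z e < C y e"
  shows "intr z e"
proof -
  have eS: "e \<in> S" using assms by (metis B_outside C_in_B less_irrefl)
  have le: "z + unitv e \<le> y"
    using assms C_le[of y e] by (auto simp: le_fun_def unitv_def)
  have zB: "z + unitv e \<in> B"
    by (rule B_between[OF assms(1,2) _ le]) (auto simp: le_fun_def unitv_def)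
  \<comment> \<open>A unit of \<open>e\<close> accepted from the larger vector \<open>y\<close> is
    accepted from the smaller \<open>z + unitv e\<close> by substitutability.\<close>
  have "z e < C (z + unitv e) e"
    using substitutable[OF assms(2) zB le, of e] assms(4) by (auto simp: unitv_def)
  then show ?thesis
    unfolding interesting_def using eS zB by (intro conjI bexI[of _ "z + unitv e"]) (auto simp: unitv_def)
qed

text \<open>Raising \<open>z\<close> at \<open>e\<close> alone stays below \<open>y\<close>, which
  is at capacity there, so consistency returns \<open>z\<close> again.\<close>

lemma not_interestingI:
  assumes "y \<in> B" "C y = z" "y e = b e"
  shows "\<not> intr z e"
proof
  assume "intr z e"
  then obtain z' where z': "z' \<in> B" "\<forall>e'. e' \<noteq> e \<longrightarrow> z' e' = z e'" "z e < z' e" "z e < C z' e" "e \<in> S"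
    unfolding interesting_def by blast
  have "z' e' \<le> y e'" for e'
    using z' assms C_le[of y e'] by (cases "e' = e") (auto simp: Bv_def)
  moreover have "z e' \<le> z' e'" for e'
    using z' by (cases "e' = e") auto
  ultimately have "C z' = z"
    using consistent[of y z'] assms z'(1) by (auto simp: le_fun_def)
  then show False using z' by simp
qed

text \<open>Substitutability shrinks an arbitrary witness of interest to \<open>z + unitv e\<close>,
  so one additional unit already suffices.\<close>

lemma interesting_add:
  assumes "acc z" "intr z e"
  shows "z + unitv e \<in> B" "C (z + unitv e) e = z e + 1"
proof -
  obtain z' where z': "z' \<in> B" "\<forall>e'. e' \<noteq> e \<longrightarrow> z' e' = z e'" "z e < z' e" "z e < C z' e"
    using assms(2) unfolding interesting_def by blast
  have le: "z + unitv e \<le> z'" using z' by (auto simp: le_fun_def unitv_def)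
  show zB: "z + unitv e \<in> B"
    by (rule B_between[OF _ z'(1) _ le, of z]) (use assms(1) in \<open>auto simp: le_fun_def unitv_def\<close>)
  show "C (z + unitv e) e = z e + 1"
    using substitutable[OF z'(1) zB le, of e] z'(4) C_le[OF zB, of e] by (auto simp: unitv_def)
qed

text \<open>The largest vector from which \<open>z\<close> is chosen.\<close>
definition cl :: "('e \<Rightarrow> int) \<Rightarrow> ('e \<Rightarrow> int)" where
  "cl z = (\<lambda>e. if e \<in> S \<and> \<not> intr z e then b e else z e)"

lemma cl_in_B: "z \<in> B \<Longrightarrow> cl z \<in> B"
  by (fastforce simp: Bv_def cl_def)

lemma le_cl: "z \<in> B \<Longrightarrow> z \<le> cl z"
  by (auto simp: Bv_def cl_def le_fun_def)

text \<open>A coordinate chosen above \<open>z\<close> would be interesting under \<open>z\<close>,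
  but there \<open>cl z\<close> offers nothing beyond \<open>z\<close>. Consistency does the
  rest.\<close>

lemma C_cl: assumes "acc z" shows "C (cl z) = z"
proof -
  have zB: "z \<in> B" using assms by simp
  have "C (cl z) e \<le> z e" for e
  proof (rule ccontr)
    assume *: "\<not> C (cl z) e \<le> z e"
    then have "intr z e" using interestingI[OF zB cl_in_B[OF zB] le_cl[OF zB]] by simp
    then show False using * C_le[OF cl_in_B[OF zB], of e] by (simp add: cl_def)
  qed
  then have "C z = C (cl z)"
    using consistent[OF cl_in_B[OF zB] zB le_cl[OF zB]] by (simp add: le_fun_def)
  then show ?thesis using assms by (simp add: acc_eq)
qed

lemma C_between_cl: "\<lbrakk>acc z; y \<in> B; z \<le> y; y \<le> cl z\<rbrakk> \<Longrightarrow> C y = z"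
  using consistent[of "cl z" y] by (simp add: C_cl cl_in_B)

text \<open>If \<open>z' \<le> cl z\<close>, the supremum of \<open>z\<close> and \<open>z'\<close>
  lies between \<open>z\<close> and \<open>cl z\<close>, so \<open>z\<close> is chosen from it.
  Comparison with a closure is thus a reflexive form of preference.\<close>

lemma le_cl_prefv:
  assumes "acc z" "acc z'" "z' \<le> cl z" "z \<noteq> z'"
  shows "prefv b S C z' z"
  using assms C_between_cl[of z "sup z z'"] by (simp add: prefv_def sup_in_B le_cl)

text \<open>This is the maximality of \<open>cl z\<close>: where \<open>z'\<close> exceeds it, one
  more unit is interesting, yet \<open>z\<close> plus this unit lies between \<open>z\<close> and
  \<open>y\<close>, so consistency rejects the unit.\<close>

lemma le_clI:
  assumes "acc z" "y \<in> B" "C y = z" "z' \<in> B" "z' \<le> y"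
  shows "z' \<le> cl z"
proof (rule le_funI, rule ccontr)
  fix e assume *: "\<not> z' e \<le> cl z e"
  have eS: "e \<in> S" using * assms B_outside[of z'] B_outside[OF cl_in_B, of z] by force
  then have "intr z e" "z e < z' e" using * assms by (auto simp: cl_def Bv_def split: if_splits)
  note i = interesting_add[OF assms(1) \<open>intr z e\<close>]
  have "(z + unitv e) e' \<le> y e'" for e'
    using \<open>z e < z' e\<close> assms C_le[of y e'] le_funD[OF assms(5), of e'] by (cases "e' = e") (auto simp: unitv_def)
  then have "C (z + unitv e) = z"
    using consistent[of y "z + unitv e"] assms i by (auto simp: le_fun_def unitv_def)
  then show False using i by simp
qed

text \<open>From the supremum of both closures the choice is still \<open>z\<close>, by
  substitutability and consistency. An edge uninteresting under \<open>z'\<close> is at capacity in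
  this supremum, hence uninteresting under \<open>z\<close> as well.\<close>

lemma interesting_antimono:
  assumes "acc z" "acc z'" "z' \<le> cl z" "intr z e"
  shows "intr z' e"
proof (rule ccontr)
  assume n: "\<not> intr z' e"
  have eS: "e \<in> S" using assms(4) by (simp add: interesting_def)
  let ?y = "sup (cl z) (cl z')"
  have B: "cl z \<in> B" "cl z' \<in> B" "?y \<in> B" using assms by (simp_all add: cl_in_B sup_in_B)
  have "C ?y e' \<le> sup z z' e'" for e'
    using substitutable[OF B(3,1), of e'] substitutable[OF B(3,2), of e'] C_le[OF B(3), of e'] assms(1,2)
    by (auto simp: C_cl sup_max max_def min_def split: if_splits)
  moreover have "sup z z' \<le> ?y"
    using assms le_cl[of z] le_cl[of z'] by (meson acc_in_B sup_mono)
  ultimately have "C (sup z z') = C ?y"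
    using consistent[of ?y "sup z z'"] B assms by (simp add: le_fun_def sup_in_B)
  moreover have "C (sup z z') = z"
    using assms C_between_cl[of z "sup z z'"] by (simp add: sup_in_B le_cl)
  moreover have "?y e = b e"
    using n eS B by (auto simp: cl_def Bv_def sup_max)
  ultimately show False using not_interestingI[OF B(3)] assms(4) by simp
qed

lemma le_cl_trans:
  assumes "acc z" "acc z'" "z'' \<in> B" "z'' \<le> cl z'" "z' \<le> cl z"
  shows "z'' \<le> cl z"
proof -
  have "cl z' e \<le> cl z e" for e
  proof (cases "intr z e")
    case True
    then show ?thesis
      using interesting_antimono[OF assms(1,2,5) True] le_funD[OF assms(5), of e] by (simp add: cl_def)
  next
    case False
    then show ?thesis using assms(1,2) by (auto simp: cl_def Bv_def acceptable_def)
  qed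
  then show ?thesis using assms(4) by (auto simp: le_fun_def intro: order_trans)
qed

section \<open>Convexity of firm-side exchanges\<close>

lemma exchange_convex:
  assumes acc: "acc x" "acc x'" "acc x''" and "x \<le> cl x'" "x' \<le> cl x''"
    and sums: "sum x' S = sum x'' S"
    and a: "intr x a" "intr x'' a" and c: "c \<in> S" "c \<noteq> a"
    and ex: "C (x + unitv a) = x + unitv a - unitv c"
    and ex'': "C (x'' + unitv a) = x'' + unitv a - unitv c"
    and gapless: "gapless b S C"
  shows "C (x' + unitv a) = x' + unitv a - unitv c"
proof -
  have aS: "a \<in> S" using a by (simp add: interesting_def)
  have a': "intr x' a" using interesting_antimono[OF acc(3,2) assms(5) a(2)] .
  note add = interesting_add[OF acc(1) a(1)] and add' = interesting_add[OF acc(2) a'] 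
    and add'' = interesting_add[OF acc(3) a(2)]
  \<comment> \<open>The vector \<open>x' + unitv a\<close> need not lie below
    \<open>x'' + unitv a\<close>, but it lies below \<open>?y\<close>, from which the same choice is
    made. This is what allows size monotonicity to compare the two.\<close>
  let ?y = "cl x'' + unitv a"
  have yB: "?y \<in> B"
    using cl_in_B[OF acc_in_B[OF acc(3)]] add''(1) a(2)
    by (auto simp: Bv_def unitv_def cl_def)
  have clB: "cl x'' \<in> B" using acc by (simp add: cl_in_B)
  have "C ?y e \<le> (x'' + unitv a) e" for e
  proof (cases "e = a")
    case True
    then show ?thesis using C_le[OF yB, of e] a(2) by (simp add: cl_def)
  next
    case False
    then show ?thesis
      using substitutable[OF yB clB, of e] C_le[OF yB, of e] acc(3)
      by (auto simp: le_fun_def C_cl unitv_def)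
  qed
  moreover have "x'' + unitv a \<le> ?y"
    using le_cl[of x''] acc(3) by (simp add: le_fun_def)
  ultimately have Cy: "C ?y = C (x'' + unitv a)"
    using consistent[OF yB add''(1)] by (simp add: le_fun_def)
  have "sum (C (x' + unitv a)) S \<le> sum (C ?y) S"
    using size_mono[OF yB add'(1)] assms(5) by (simp add: le_fun_def)
  then have le: "sum (C (x' + unitv a)) S \<le> sum x' S"
    unfolding Cy ex'' sums using aS c by (simp only: sum_add_unitv sum_diff_unitv)
  have "sum x' S \<le> sum (C (x' + unitv a)) S"
    using size_mono[OF add'(1), of x'] acc(2) by (simp add: le_fun_def unitv_def acc_eq)
  then have ge: "sum (x' + unitv a) S \<le> sum (C (x' + unitv a)) S + 1"
    using aS by (simp only: sum_add_unitv)
  have Cle: "C (x' + unitv a) \<le> x' + unitv a"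
    using C_le[OF add'(1)] by (rule le_funI)
  \<comment> \<open>The two size bounds leave exactly one rejected unit: rejecting none would
    violate the upper bound \<open>le\<close>.\<close>
  from add' ge obtain c' where c': "c' \<in> S" "x' + unitv a = C (x' + unitv a) + unitv c'"
  proof (elim eq_or_add_unitv[rotated 3])
    assume "x' + unitv a = C (x' + unitv a)"
    then have "sum (C (x' + unitv a)) S = sum x' S + 1" using aS sum_add_unitv by metis
    then show ?thesis using le by simp
  qed (use Cle in auto)
  have ex': "C (x' + unitv a) = x' + unitv a - unitv c'"
    using c'(2) by (simp add: eq_diff_eq)
  show ?thesis
  \<comment> \<open>The relation \<open>prefv\<close> is irreflexive, so coinciding neighbours are
    treated before gaplessness is applied.\<close>
  proof (cases "x = x' \<or> x' = x''")
    case True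
    then show ?thesis using ex ex'' by auto
  next
    case False
    then have "prefv b S C x x'" "prefv b S C x' x''"
      using le_cl_prefv acc assms(4,5) by metis+
    then have "c = c'"
      using gapless ex ex' ex'' acc add(1) add'(1) add''(1) aS c(1) c'(1)
      unfolding gapless_def by blast
    then show ?thesis using ex' by simp
  qed
qed

text \<open>By substitutability, a unit of \<open>c\<close> rejected when one \<open>a\<close> is
  added is also rejected when all of \<open>A\<close> is added. This bounds the joint choice from
  above, and the totals force equality.\<close>

lemma C_add_units:
  assumes x: "acc x" and A: "finite A" "\<And>a. a \<in> A \<Longrightarrow> intr x a" and D: "finite D" "D \<subseteq> S" "A \<inter> D = {}"
    and cover: "\<And>c. c \<in> D \<Longrightarrow> \<exists>a\<in>A. C (x + unitv a) = x + unitv a - unitv c"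
    and card: "card A = card D"
  shows "(\<lambda>e. x e + (if e \<in> A then 1 else 0)) \<in> B"
    and "C (\<lambda>e. x e + (if e \<in> A then 1 else 0))
      = (\<lambda>e. x e + (if e \<in> A then 1 else if e \<in> D then -1 else 0))"
proof -
  let ?u = "\<lambda>e. x e + (if e \<in> A then 1 else 0)"
  let ?y = "\<lambda>e. x e + (if e \<in> A then 1 else if e \<in> D then -1 else 0)"
  have AS: "A \<subseteq> S" using A by (auto simp: interesting_def)
  have xB: "x \<in> B" using x by simp
  have "x e + 1 \<le> b e" if "e \<in> A" for e
    using interesting_add(1)[OF x A(2)[OF that]] subsetD[OF AS that] by (auto simp: Bv_def unitv_def)
  then show uB: "?u \<in> B" using xB AS by (auto simp: Bv_def)
  have le: "C ?u e \<le> ?y e" for e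
  proof (cases "e \<in> D")
    case True
    then obtain a where a: "a \<in> A" "C (x + unitv a) = x + unitv a - unitv e" using cover by blast
    have "e \<notin> A" "e \<noteq> a" using a True D by auto
    have "x + unitv a \<le> ?u" using a by (auto simp: le_fun_def unitv_def)
    from substitutable[OF uB interesting_add(1)[OF x A(2)[OF a(1)]] this, of e]
    show ?thesis using a True \<open>e \<notin> A\<close> \<open>e \<noteq> a\<close> by (auto simp: unitv_def)
  next
    case False
    then show ?thesis using C_le[OF uB, of e] by auto
  qed
  have yB: "?y \<in> B"
    by (rule B_between[OF C_in_B[OF uB] uB]) (use le in \<open>auto simp: le_fun_def\<close>)
  have "sum ?y S = sum x S + (\<Sum>e\<in>S. (if e \<in> A then 1 else 0) - (if e \<in> D then 1 else 0))"
    unfolding sum.distrib[symmetric] using D(3) by (intro sum.cong) auto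
  also have "(\<Sum>e\<in>S. (if e \<in> A then 1 else 0) - (if e \<in> D then 1 else 0)) = int (card A) - int (card D)"
    using A(1) AS D finite_S by (simp add: sum_subtractf sum.If_cases Int_absorb1)
  finally have "sum ?y S = sum x S" using card by simp
  moreover have "sum x S \<le> sum (C ?u) S"
    using size_mono[OF uB xB] x by (auto simp: le_fun_def acc_eq)
  ultimately show "C ?u = ?y"
    using eq_if_sum_le[OF C_in_B[OF uB] yB] le by (auto simp: le_fun_def)
qed

lemma interesting_if_less:
  assumes "acc x" "acc y" "y \<le> cl x" "y e < x e"
  shows "intr y e"
proof (rule interestingI)
  show "sup x y \<in> B" "y \<in> B" "y \<le> sup x y" using assms by (simp_all add: sup_in_B)
  show "y e < C (sup x y) e"
    using assms C_between_cl[of x "sup x y"] by (simp add: sup_in_B le_cl)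
qed

text \<open>For a worker \<open>w\<close> and a stable \<open>x\<close>, taking for \<open>U\<close> the edges that are interesting for the
  firms, this is what the firms offer to \<open>w\<close>.\<close>
definition offer :: "'e set \<Rightarrow> ('e \<Rightarrow> int) \<Rightarrow> ('e \<Rightarrow> int)" where
  "offer U x = (\<lambda>e. if e \<in> U then b e else x e)"

section \<open>The choice of a worker from an offer\<close>

context
  fixes U x
  assumes acc_x: "acc x" and U: "U \<subseteq> S" and not_intr: "\<And>e. e \<in> U \<Longrightarrow> \<not> intr x e"
begin

lemma offer_in_B: "offer U x \<in> B"
  using acc_in_B[OF acc_x] U by (fastforce simp: Bv_def offer_def)

lemma C_offer: "C (offer U x) = x"
proof (rule C_between_cl[OF acc_x offer_in_B])
  show "x \<le> offer U x"
    using acc_in_B[OF acc_x] U by (fastforce simp: Bv_def offer_def le_fun_def)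
  show "offer U x \<le> cl x"
    using acc_in_B[OF acc_x] U not_intr by (fastforce simp: Bv_def offer_def le_fun_def cl_def)
qed

context
  fixes c
  assumes c: "c \<in> S" "c \<notin> U" "0 < x c"
begin

lemma offer_diff_in_B: "offer U x - unitv c \<in> B"
  using offer_in_B c by (auto simp: Bv_def offer_def unitv_def)

lemma le_C_offer_diff: "x - unitv c \<le> C (offer U x - unitv c)"
proof (rule le_funI)
  fix e
  have "offer U x - unitv c \<le> offer U x" by (simp add: le_fun_def unitv_def)
  from substitutable[OF offer_in_B offer_diff_in_B this, of e] C_le[OF offer_in_B, of e]
  show "(x - unitv c) e \<le> C (offer U x - unitv c) e"
    using C_offer by (auto simp: unitv_def)
qed

text \<open>After a unit of \<open>c\<close> is withdrawn, substitutability keeps the rest of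
  \<open>x\<close> and size monotonicity admits at most one replacement. It comes from
  \<open>U\<close>, since elsewhere the offer has nothing to spare.\<close>

lemma C_offer_diff:
  obtains "C (offer U x - unitv c) = x - unitv c"
  | a where "a \<in> U" "a \<noteq> c" "C (offer U x - unitv c) = x + unitv a - unitv c"
proof -
  let ?q = "offer U x - unitv c"
  have xB: "x - unitv c \<in> B"
    using acc_in_B[OF acc_x] c by (auto simp: Bv_def unitv_def)
  have "sum (C ?q) S \<le> sum (C (offer U x)) S"
    using size_mono[OF offer_in_B offer_diff_in_B] by (simp add: le_fun_def unitv_def)
  then have le: "sum (C ?q) S \<le> sum (x - unitv c) S + 1"
    unfolding C_offer using c by (simp only: sum_diff_unitv)
  show ?thesis
  proof (rule eq_or_add_unitv[OF xB C_in_B[OF offer_diff_in_B] le_C_offer_diff le])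
    fix a assume a: "a \<in> S" "C ?q = x - unitv c + unitv a"
    have "C ?q a \<le> ?q a" by (rule C_le[OF offer_diff_in_B])
    then have "a \<in> U \<and> a \<noteq> c"
      using a(2) c by (auto simp: unitv_def offer_def split: if_splits)
    then show ?thesis using a(2) that(2)[of a] by (simp add: algebra_simps)
  qed (use that in blast)
qed

text \<open>Recasts an essential pair as the response to a withdrawal: \<open>a\<close> is what
  replaces \<open>c\<close>. No replacement would make the choice smaller than the acceptable
  \<open>?z\<close> below the offer, and a replacement other than \<open>a\<close> would be
  interesting under \<open>?z\<close>.\<close>

lemma essential_iff:
  assumes a: "a \<in> U"
  shows "acc (x + unitv a - unitv c) \<and> \<not> (\<exists>d\<in>U - {a}. intr (x + unitv a - unitv c) d)
    \<longleftrightarrow> C (offer U x - unitv c) = x + unitv a - unitv c" (is "acc ?z \<and> \<not> (\<exists>d\<in>_. _ d) \<longleftrightarrow> C ?q = _")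
proof
  assume *: "acc ?z \<and> \<not> (\<exists>d\<in>U - {a}. intr ?z d)"
  have ac: "a \<noteq> c" using a c by auto
  have zq: "?z \<le> ?q"
  proof (rule le_funI)
    fix e
    have "?z \<in> B" using * by simp
    then have "?z a \<le> b a" using a U by (auto simp: Bv_def)
    moreover have "x e \<le> offer U x e" using C_le[OF offer_in_B, of e] C_offer by simp
    ultimately show "?z e \<le> ?q e" using a ac by (auto simp: unitv_def offer_def)
  qed
  show "C ?q = ?z"
  proof (rule C_offer_diff)
    assume eq: "C ?q = x - unitv c"
    have "sum (C ?z) S \<le> sum (C ?q) S"
      using size_mono[OF offer_diff_in_B _ zq] * by simp
    then have "sum ?z S \<le> sum (x - unitv c) S" using * eq by (simp add: acc_eq)
    then show ?thesis using a U c by (simp only: sum_diff_unitv sum_add_unitv subsetD)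
  next
    fix a' assume a': "a' \<in> U" "C ?q = x + unitv a' - unitv c"
    have "a' = a"
    proof (rule ccontr)
      assume "a' \<noteq> a"
      then have "?z a' < C ?q a'" using a' by (simp add: unitv_def)
      then have "intr ?z a'" using interestingI[OF _ offer_diff_in_B zq] * by simp
      then show False using * a' \<open>a' \<noteq> a\<close> by auto
    qed
    then show ?thesis using a' by (simp only:)
  qed
next
  assume eq: "C ?q = ?z"
  have "\<not> intr ?z d" if "d \<in> U" for d
  proof (rule not_interestingI[OF offer_diff_in_B eq])
    show "?q d = b d" using that c by (auto simp: offer_def unitv_def)
  qed
  then show "acc ?z \<and> \<not> (\<exists>d\<in>U - {a}. intr ?z d)"
    using acc_C[OF offer_diff_in_B] eq by auto
qed

end

text \<open>Dual to \<open>C_add_units\<close>: a replacement accepted when one \<open>c\<close> is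
  withdrawn remains accepted when all of \<open>D\<close> is withdrawn. This bounds the choice from
  below, and the totals force equality.\<close>

lemma C_offer_diffs:
  assumes D: "finite D" "D \<subseteq> S" "D \<inter> U = {}" "\<And>c. c \<in> D \<Longrightarrow> 0 < x c"
    and A: "A \<subseteq> U" "finite A"
    and cover: "\<And>a. a \<in> A \<Longrightarrow> \<exists>c\<in>D. C (offer U x - unitv c) = x + unitv a - unitv c"
    and card: "card A = card D"
  shows "(\<lambda>e. offer U x e - (if e \<in> D then 1 else 0)) \<in> B"
    and "C (\<lambda>e. offer U x e - (if e \<in> D then 1 else 0))
      = (\<lambda>e. x e + (if e \<in> A then 1 else if e \<in> D then -1 else 0))"
proof -
  let ?q = "\<lambda>e. offer U x e - (if e \<in> D then 1 else 0)"
  let ?y = "\<lambda>e. x e + (if e \<in> A then 1 else if e \<in> D then -1 else 0)"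
  have AD: "A \<inter> D = {}" using A D by auto
  show qB: "?q \<in> B" using offer_in_B D by (force simp: Bv_def offer_def)
  have ge: "?y e \<le> C ?q e" for e
  proof (cases "e \<in> A")
    case True
    then obtain c where c: "c \<in> D" "C (offer U x - unitv c) = x + unitv e - unitv c"
      using cover by blast
    have "c \<in> S" "c \<notin> U" "0 < x c" "c \<noteq> e" "e \<notin> D" using c(1) D AD True by auto
    note B = offer_diff_in_B[OF this(1-3)]
    have "?q \<le> offer U x - unitv c" using c(1) by (auto simp: le_fun_def unitv_def)
    from substitutable[OF B qB this, of e] C_le[OF B, of e] show ?thesis
      using c(2) True \<open>e \<notin> D\<close> \<open>c \<noteq> e\<close> by (auto simp: unitv_def)
  next
    case False
    have "?q \<le> offer U x" by (auto simp: le_fun_def)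
    from substitutable[OF offer_in_B qB this, of e] C_le[OF offer_in_B, of e] show ?thesis
      using C_offer False by auto
  qed
  have x0: "x \<in> B" using acc_x by simp
  have yB: "?y \<in> B"
  proof -
    have "(\<lambda>e. x e - (if e \<in> D then 1 else 0)) \<in> B" using x0 D by (force simp: Bv_def)
    then show ?thesis
      by (rule B_between[OF _ C_in_B[OF qB]]) (use ge in \<open>auto simp: le_fun_def\<close>)
  qed
  have "sum ?y S = sum x S + (\<Sum>e\<in>S. (if e \<in> A then 1 else 0) - (if e \<in> D then 1 else 0))"
    unfolding sum.distrib[symmetric] using AD by (intro sum.cong) auto
  also have "(\<Sum>e\<in>S. (if e \<in> A then 1 else 0) - (if e \<in> D then 1 else 0)) = int (card A) - int (card D)"
    using A D U finite_S by (simp add: sum_subtractf sum.If_cases Int_absorb1 subset_trans)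
  finally have "sum ?y S = sum x S" using card by simp
  moreover have "sum (C ?q) S \<le> sum x S"
    using size_mono[OF offer_in_B qB] C_offer by (auto simp: le_fun_def)
  ultimately show "C ?q = ?y"
    using eq_if_sum_le[OF yB C_in_B[OF qB]] ge by (auto simp: le_fun_def)
qed

end

section \<open>Convexity of worker-side exchanges\<close>

lemma essential_convex:
  assumes acc: "acc x" "acc x'" "acc x''"
    and U: "U \<subseteq> S" "U' \<subseteq> U" "U'' \<subseteq> U'"
    and not_intr: "\<And>e. e \<in> U \<Longrightarrow> \<not> intr x e" "\<And>e. e \<in> U' \<Longrightarrow> \<not> intr x' e"
      "\<And>e. e \<in> U'' \<Longrightarrow> \<not> intr x'' e"
    and le: "\<And>e. e \<notin> U \<Longrightarrow> x' e \<le> x e" "\<And>e. e \<notin> U' \<Longrightarrow> x'' e \<le> x' e"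
    and sums: "sum x' S = sum x'' S"
    and c: "c \<in> S" "c \<notin> U" "0 < x'' c" and a: "a \<in> U''"
    and ex: "C (offer U x - unitv c) = x + unitv a - unitv c"
    and ex'': "C (offer U'' x'' - unitv c) = x'' + unitv a - unitv c"
    and gapless: "gapless b S C"
  shows "C (offer U' x' - unitv c) = x' + unitv a - unitv c"
proof -
  have c': "c \<notin> U'" "c \<notin> U''" using c U by auto
  then have "0 < x' c" "0 < x c" using c le(1)[of c] le(2)[of c] by auto
  note c' = c' this
  have U': "U' \<subseteq> S" "U'' \<subseteq> S" using U by auto
  have qB: "offer U x - unitv c \<in> B" and q'B: "offer U' x' - unitv c \<in> B"
    and q''B: "offer U'' x'' - unitv c \<in> B"
    using offer_diff_in_B acc U U' not_intr c c' by blast+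
  have bd: "y e \<le> b e" if "y \<in> B" "e \<in> S" for y e using that by (auto simp: Bv_def)
  \<comment> \<open>Offers shrink along the chain: on the shrinking sets they are at capacity, and
    off them values only decrease.\<close>
  have q'q: "offer U' x' - unitv c \<le> offer U x - unitv c"
    using U le acc bd[of x'] by (auto simp: le_fun_def offer_def)
  have q''q': "offer U'' x'' - unitv c \<le> offer U' x' - unitv c"
    using U le acc bd[of x''] by (auto simp: le_fun_def offer_def)
  have aS: "a \<in> S" using a U by auto
  \<comment> \<open>The replacement \<open>a\<close> keeps the total at \<open>x''\<close>, and the
    choice from the larger offer at \<open>x'\<close> is no smaller. So a withdrawal of
    \<open>c\<close> at \<open>x'\<close> cannot remain without a replacement.\<close>
  have ge: "sum x'' S \<le> sum (C (offer U' x' - unitv c)) S"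
    using size_mono[OF q'B q''B q''q'] unfolding ex'' using aS c by (simp only: sum_diff_unitv sum_add_unitv)
  obtain a' where a': "a' \<in> U'" "a' \<noteq> c" "C (offer U' x' - unitv c) = x' + unitv a' - unitv c"
  proof (rule C_offer_diff[OF acc(2) U'(1) not_intr(2) c(1) c'(1,3)])
    assume "C (offer U' x' - unitv c) = x' - unitv c"
    then have "sum x'' S \<le> sum (x' - unitv c) S" using ge by simp
    then show ?thesis using sums c by (simp only: sum_diff_unitv)
  qed blast+
  text \<open>Gaplessness is applied to the chosen vectors, with the roles of \<open>a\<close> and \<open>c\<close> exchanged:
    adding \<open>c\<close> back to \<open>x + unitv a - unitv c\<close> expels \<open>a\<close>.\<close>
  have restore: "C (y + unitv d - unitv c + unitv c) = y + unitv d - unitv c + unitv c - unitv d"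
     "y + unitv d - unitv c + unitv c \<in> B" "acc (y + unitv d - unitv c)"
    if y: "acc y" "V \<subseteq> S" "\<forall>e\<in>V. \<not> intr y e" "c \<notin> V" "0 < y c" "d \<in> V"
      and e: "C (offer V y - unitv c) = y + unitv d - unitv c" for y V d
  proof -
    have eq: "y + unitv d - unitv c + unitv c = y + unitv d"
      "y + unitv d - unitv c + unitv c - unitv d = y" by simp_all
    have B: "offer V y - unitv c \<in> B" by (rule offer_diff_in_B[OF y(1,2) bspec[OF y(3)] c(1) y(4,5)])
    then show "acc (y + unitv d - unitv c)" using acc_C e by metis
    have "c \<noteq> d" using y by auto
    have "(y + unitv d) e \<le> offer V y e" for e
      using C_le[OF B, of e] e \<open>c \<noteq> d\<close> by (auto simp: unitv_def offer_def split: if_splits)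
    then have le: "y + unitv d \<le> offer V y" by (simp add: le_fun_def)
    have yB: "y + unitv d \<in> B"
      by (rule B_between[OF _ offer_in_B[OF y(1,2) bspec[OF y(3)]] _ le, of y]) (use y(1) in \<open>auto simp: le_fun_def unitv_def\<close>)
    then show "y + unitv d - unitv c + unitv c \<in> B" by (simp only: eq)
    have "C (y + unitv d) = y"
      using consistent[OF offer_in_B[OF y(1,2) bspec[OF y(3)]] yB le] C_offer[OF y(1,2) bspec[OF y(3)]] by (simp add: le_fun_def unitv_def)
    then show "C (y + unitv d - unitv c + unitv c) = y + unitv d - unitv c + unitv c - unitv d"
      by (simp only: eq add_diff_cancel_right')
  qed
  have aU: "a \<in> U" "a \<in> U'" using a U by auto
  have n: "\<forall>e\<in>U. \<not> intr x e" "\<forall>e\<in>U'. \<not> intr x' e" "\<forall>e\<in>U''. \<not> intr x'' e"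
    using not_intr by blast+
  let ?z = "x + unitv a - unitv c" and ?z' = "x' + unitv a' - unitv c" and ?z'' = "x'' + unitv a - unitv c"
  note restore1 = restore[OF acc(1) U(1) n(1) c(2) c'(4) aU(1) ex]
    and restore2 = restore[OF acc(2) U'(1) n(2) c'(1,3) a'(1,3)]
    and restore3 = restore[OF acc(3) U'(2) n(3) c'(2) c(3) a ex'']
  \<comment> \<open>Each chosen vector fits into the offer preceding it, so the worker's preference
    decreases along the chain and gaplessness receives the vectors in reverse order.\<close>
  have prefv1: "prefv b S C ?z' ?z" if "?z \<noteq> ?z'"
    by (rule le_cl_prefv[OF restore1(3) restore2(3) _ that], rule le_clI[OF restore1(3) qB ex])
      (use restore2(3) q'q C_le[OF q'B] a'(3) in \<open>auto simp: le_fun_def intro: order_trans\<close>)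
  have prefv2: "prefv b S C ?z'' ?z'" if "?z' \<noteq> ?z''"
    by (rule le_cl_prefv[OF restore2(3) restore3(3) _ that], rule le_clI[OF restore2(3) q'B a'(3)])
      (use restore3(3) q''q' C_le[OF q''B] ex'' in \<open>auto simp: le_fun_def intro: order_trans\<close>)
  have inj: "d = d'" if "y + unitv d - unitv c = y' + unitv d' - unitv c" "y = y'" for y y' :: "'e \<Rightarrow> int" and d d'
  proof -
    have "unitv d = unitv d'" using that by simp
    then show ?thesis by (rule unitv_inject)
  qed
  have "a = a'"
  \<comment> \<open>If neighbouring chosen vectors coincide, restoring \<open>c\<close> recovers the
    same original vector from both, and the replacements agree.\<close>
  proof (cases "?z = ?z' \<or> ?z' = ?z''")
    case True
    then show ?thesis
    proof
      assume *: "?z = ?z'"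
      then have "x = x'" using restore1(1) restore2(1) by simp
      then show ?thesis using inj * by blast
    next
      assume *: "?z' = ?z''"
      then have "x' = x''" using restore2(1) restore3(1) by simp
      then show ?thesis using inj * by blast
    qed
  next
    case False
    have "a \<in> S" "a' \<in> S" using aU a' U by auto
    then show ?thesis
      using gapless[unfolded gapless_def, rule_format, of ?z'' ?z' ?z c a a' a]
        False prefv1 prefv2 restore1 restore2 restore3 c(1) by auto
  qed
  then show ?thesis using a' by simp
qed

end

section \<open>Rotations as cycles\<close>

text \<open>The worker-side arcs of the cycle, from each \<open>c\<close> to the next
  \<open>a\<close> in cyclic order; the firm-side arcs are the entries of the list itself.\<close>

definition w_pairs :: "('e \<times> 'e) list \<Rightarrow> ('e \<times> 'e) list" where
  "w_pairs R = zip (map snd R) (rotate1 (map fst R))"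

text \<open>The sum type keeps firm-side pairs \<open>(a, c)\<close> apart from worker-side pairs
  \<open>(c, a)\<close>. Arcs joining the two copies of one edge are left out, as they carry no
  choice.\<close>

definition rot_arcs :: "('e \<times> 'e) list \<Rightarrow> ('e \<times> 'e + 'e \<times> 'e) set" where
  "rot_arcs R = Inl ` set R \<union> Inr ` set (w_pairs R)"

lemma w_pairs_nth:
  assumes "i < length R"
  shows "w_pairs R ! i = (snd (R ! i), fst (R ! (Suc i mod length R)))"
proof -
  have "Suc i mod length R < length R" using assms by (intro mod_less_divisor) auto
  then show ?thesis using assms by (simp add: w_pairs_def nth_rotate1)
qed

lemma length_w_pairs [simp]: "length (w_pairs R) = length R"
  by (simp add: w_pairs_def)

lemma fst_w_pairs: "fst ` set (w_pairs R) = snd ` set R"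
  unfolding w_pairs_def set_map[symmetric] by simp

lemma snd_w_pairs: "snd ` set (w_pairs R) = fst ` set R"
  unfolding w_pairs_def set_map[symmetric] by simp

lemma w_pairs_rotate1: "set (w_pairs (rotate1 R)) = set (w_pairs R)"
proof (cases R)
  case (Cons x xs)
  show ?thesis
  proof (cases xs)
    case (Cons y ys)
    have "zip (snd y # map snd ys @ [snd x]) (map fst ys @ [fst x, fst y])
      = zip (snd y # map snd ys) (map fst ys @ [fst x]) @ [(snd x, fst y)]"
      using zip_append[of "snd y # map snd ys" "map fst ys @ [fst x]" "[snd x]" "[fst y]"] by simp
    then show ?thesis using \<open>R = x # xs\<close> Cons by (auto simp: w_pairs_def)
  qed (simp add: \<open>R = x # xs\<close>)
qed simp

lemma w_pairs_rotate: "set (w_pairs (rotate n R)) = set (w_pairs R)"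
  by (induction n) (simp_all add: w_pairs_rotate1)

lemma rot_arcs_same_rot: "same_rot R R' \<Longrightarrow> rot_arcs R' = rot_arcs R"
  by (auto simp: same_rot_def rot_arcs_def w_pairs_rotate)

lemma distinct_concat_pairs:
  assumes "distinct (concat (map (\<lambda>(a, c). [a, c]) R))"
  shows "distinct (map fst R)" "distinct (map snd R)" "fst ` set R \<inter> snd ` set R = {}"
  using assms by (induction R) force+

text \<open>With \<open>S\<close> the edges at one vertex, this says that a cycle raises as many
  edges there as it lowers.\<close>

lemma card_fst_eq_snd:
  assumes "inj_on fst P" "inj_on snd P" "\<And>p. p \<in> P \<Longrightarrow> fst p \<in> S \<longleftrightarrow> snd p \<in> S"
  shows "card (fst ` P \<inter> S) = card (snd ` P \<inter> S)"
proof -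
  let ?P = "{p \<in> P. fst p \<in> S}"
  have "fst ` P \<inter> S = fst ` ?P" "snd ` P \<inter> S = snd ` ?P" using assms(3) by auto
  moreover have "inj_on fst ?P" "inj_on snd ?P" using assms(1,2) by (auto intro: inj_on_subset)
  ultimately show ?thesis by (simp add: card_image)
qed

definition active :: "('w,'f) market \<Rightarrow> (('w \<times> 'f) \<Rightarrow> int) \<Rightarrow>
    ('w \<times> 'f) \<times> ('w \<times> 'f) + ('w \<times> 'f) \<times> ('w \<times> 'f) \<Rightarrow> bool" where
  "active G x p = (case p of Inl (a, c) \<Rightarrow> legal_f G x a c | Inr (c, a) \<Rightarrow> essential_w G x c a)"

text \<open>A rotation, except that the membership of its nodes in \<^const>\<open>core\<close> is dropped.\<close>
definition active_cycle :: "('w,'f) market \<Rightarrow> (('w \<times> 'f) \<Rightarrow> int) \<Rightarrow> (('w \<times> 'f) \<times> ('w \<times> 'f)) list \<Rightarrow> bool" where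
  "active_cycle G x R \<longleftrightarrow> R \<noteq> [] \<and> distinct (map fst R) \<and> distinct (map snd R) \<and>
    fst ` set R \<inter> snd ` set R = {} \<and> (\<forall>p\<in>rot_arcs R. active G x p)"

text \<open>Only the exchange pairs are retained, because these are what convexity transfers between
  members of a route.\<close>

lemma rotation_active_cycle:
  assumes "rotation_of G x R"
  shows "active_cycle G x R"
proof -
  have "legal_f G x (fst (R ! i)) (snd (R ! i)) \<and>
      essential_w G x (snd (R ! i)) (fst (R ! (Suc i mod length R)))" if "i < length R" for i
    using assms that unfolding rotation_of_def Let_def arc_def by auto
  then have "active G x (Inl (R ! i))" "active G x (Inr (w_pairs R ! i))" if "i < length R" for i
    using that by (simp_all add: active_def w_pairs_nth case_prod_unfold)
  then have "\<forall>p\<in>rot_arcs R. active G x p"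
    by (auto simp: rot_arcs_def in_set_conv_nth simp del: split_paired_All) (metis length_w_pairs)+
  then show ?thesis
    using assms distinct_concat_pairs[of R] unfolding rotation_of_def active_cycle_def by blast
qed

lemma active_cycleD:
  assumes "active_cycle G x R"
  shows "(a, c) \<in> set R \<Longrightarrow> legal_f G x a c"
    and "(c, a) \<in> set (w_pairs R) \<Longrightarrow> essential_w G x c a"
proof -
  have *: "active G x p" if "p \<in> rot_arcs R" for p
    using assms that by (simp add: active_cycle_def)
  show "(a, c) \<in> set R \<Longrightarrow> legal_f G x a c"
    using *[of "Inl (a, c)"] by (simp add: rot_arcs_def active_def)
  show "(c, a) \<in> set (w_pairs R) \<Longrightarrow> essential_w G x c a"
    using *[of "Inr (c, a)"] by (simp add: rot_arcs_def active_def)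
qed

section \<open>Stable g-matchings along a route\<close>

locale market_setting =
  fixes G :: "('w,'f) market"
  assumes wf: "wf_market G"
begin

abbreviation "E \<equiv> Eset G"
abbreviation "xw w x \<equiv> rs (Ew G w) x"
abbreviation "xf f x \<equiv> rs (Ef G f) x"
abbreviation "clW w \<equiv> choice_function.cl (cap G) (Ew G w) (CW G w)"
abbreviation "clF f \<equiv> choice_function.cl (cap G) (Ef G f) (CF G f)"
abbreviation "U \<equiv> Uplus G"

lemma finite_E: "finite E"
  using wf unfolding wf_market_def by (meson finite_SigmaI finite_subset)

lemma choice_W: "w \<in> Wset G \<Longrightarrow> choice_function (cap G) (Ew G w) (CW G w)"
  using wf finite_E by (simp add: choice_function_def wf_market_def Ew_def)

lemma choice_F: "f \<in> Fset G \<Longrightarrow> choice_function (cap G) (Ef G f) (CF G f)"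
  using wf finite_E by (simp add: choice_function_def wf_market_def Ef_def)

lemma edge_ends: "e \<in> E \<Longrightarrow> fst e \<in> Wset G" "e \<in> E \<Longrightarrow> snd e \<in> Fset G"
  using wf by (auto simp: wf_market_def)

lemma stable_acc:
  assumes "stable G x"
  shows "w \<in> Wset G \<Longrightarrow> acceptable (cap G) (Ew G w) (CW G w) (xw w x)"
    and "f \<in> Fset G \<Longrightarrow> acceptable (cap G) (Ef G f) (CF G f) (xf f x)"
  using assms by (auto simp: stable_def gmatching_def)

lemma stable_bounds: "stable G x \<Longrightarrow> e \<in> E \<Longrightarrow> 0 \<le> x e \<and> x e \<le> cap G e"
  by (simp add: stable_def gmatching_def)

lemma Uplus_iff: "e \<in> U x \<longleftrightarrow> e \<in> E \<and> interesting (cap G) (Ef G (snd e)) (CF G (snd e)) (xf (snd e) x) e"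
  by (simp add: Uplus_def intF_def)

lemma Uplus_not_interesting_W:
  assumes "stable G x" "e \<in> U x \<inter> Ew G w"
  shows "\<not> interesting (cap G) (Ew G w) (CW G w) (xw w x) e"
  using assms by (auto simp: stable_def blocks_def Uplus_iff intW_def intF_def Ew_def)

text \<open>The firms' order expressed through closures, strengthened by what the convexity lemmas
  consume: values fall off \<open>U x\<close>, and totals at every vertex are constant.\<close>

definition below :: "(('w \<times> 'f) \<Rightarrow> int) \<Rightarrow> (('w \<times> 'f) \<Rightarrow> int) \<Rightarrow> bool" where
  "below x y \<longleftrightarrow> (\<forall>f\<in>Fset G. xf f x \<le> clF f (xf f y)) \<and> (\<forall>e. e \<notin> U x \<longrightarrow> y e \<le> x e) \<and>
    (\<forall>w. sum y (Ew G w) = sum x (Ew G w)) \<and> (\<forall>f. sum y (Ef G f) = sum x (Ef G f))"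

lemma belowD:
  assumes "below x y"
  shows "f \<in> Fset G \<Longrightarrow> xf f x \<le> clF f (xf f y)" and "e \<notin> U x \<Longrightarrow> y e \<le> x e"
    and "sum y (Ew G w) = sum x (Ew G w)" and "sum y (Ef G f) = sum x (Ef G f)"
  using assms unfolding below_def by blast+

lemma below_refl:
  assumes "stable G x"
  shows "below x x"
proof -
  have "xf f x \<le> clF f (xf f x)" if "f \<in> Fset G" for f
    using choice_function.le_cl[OF choice_F[OF that]] stable_acc(2)[OF assms that]
    by (simp add: acceptable_def)
  then show ?thesis by (simp add: below_def)
qed

lemma Uplus_antimono:
  assumes "stable G x" "stable G y" "below x y"
  shows "U y \<subseteq> U x"
proof
  fix e assume e: "e \<in> U y"
  then have f: "snd e \<in> Fset G" by (simp add: Uplus_iff edge_ends)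
  show "e \<in> U x"
    using choice_function.interesting_antimono[OF choice_F[OF f] stable_acc(2)[OF assms(2) f]
        stable_acc(2)[OF assms(1) f], of e] e assms(3) f
    by (auto simp: Uplus_iff below_def)
qed

lemma below_trans:
  assumes st: "stable G x" "stable G y" "stable G z" and "below x y" "below y z"
  shows "below x z"
proof -
  have "xf f x \<le> clF f (xf f z)" if f: "f \<in> Fset G" for f
    using choice_function.le_cl_trans[OF choice_F[OF f] stable_acc(2)[OF st(3) f] stable_acc(2)[OF st(2) f], of "xf f x"]
      stable_acc(2)[OF st(1) f] assms f by (simp add: acceptable_def below_def)
  moreover have "z e \<le> x e" if "e \<notin> U x" for e
  proof -
    have "e \<notin> U y" using that Uplus_antimono[OF st(1,2) assms(4)] by blast
    then have "z e \<le> y e" "y e \<le> x e" using that belowD(2) assms(4,5) by blast+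
    then show ?thesis by simp
  qed
  ultimately show ?thesis using assms by (simp add: below_def)
qed

lemma sum_rs: "sum (rs S x) S = sum x S"
  by (simp add: rs_def)

abbreviation "offerW \<equiv> choice_function.offer (cap G)"

text \<open>Stability makes every edge of \<open>U x\<close> uninteresting for its worker, which is
  the hypothesis under which pairs can be read as responses to withdrawals.\<close>

lemma essential_w_iff:
  assumes st: "stable G x" and c: "c \<in> Uminus G x" and a: "a \<in> U x" "fst a = fst c"
  defines "w \<equiv> fst c"
  shows "essential_w G x c a \<longleftrightarrow>
    CW G w (offerW (U x \<inter> Ew G w) (xw w x) - unitv c) = xw w x + unitv a - unitv c"
proof -
  have w: "w \<in> Wset G" using c edge_ends by (simp add: Uminus_def w_def)
  have cw: "c \<in> Ew G w" "c \<notin> U x \<inter> Ew G w" "0 < xw w x c"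
    using c by (auto simp: Uminus_def Ew_def w_def rs_def Uplus_def)
  have "a \<in> U x \<inter> Ew G w" using a by (auto simp: Ew_def Uplus_def w_def)
  from choice_function.essential_iff[OF choice_W[OF w] stable_acc(1)[OF st w] _ _ cw this]
  show ?thesis
    using c a Uplus_not_interesting_W[OF st] by (simp add: essential_w_def legal_w_def w_def)
qed

section \<open>Persistence of exchange pairs between stable g-matchings\<close>

lemma legal_f_facts:
  assumes "legal_f G x a c"
  shows "a \<in> U x" "a \<in> E" "c \<in> E" "snd c = snd a" "a \<noteq> c"
  using assms by (auto simp: legal_f_def Uplus_def Ef_def)

lemma essential_w_facts:
  assumes "essential_w G x c a"
  shows "a \<in> U x" "a \<in> E" "c \<in> Uminus G x" "c \<in> E" "fst a = fst c"
  using assms by (auto simp: essential_w_def legal_w_def Uplus_def Uminus_def)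

lemma legal_f_convex:
  assumes gl: "all_gapless G" and st: "stable G x" "stable G x'" "stable G x''"
    and b: "below x x'" "below x' x''" and l: "legal_f G x a c" "legal_f G x'' a c"
  shows "legal_f G x' a c"
proof -
  let ?f = "snd a"
  note facts = legal_f_facts[OF l(1)]
  have f: "?f \<in> Fset G" using facts edge_ends by simp
  have a: "a \<in> U x'" using legal_f_facts(1)[OF l(2)] Uplus_antimono[OF st(2,3) b(2)] by auto
  have "CF G ?f (xf ?f x' + unitv a) = xf ?f x' + unitv a - unitv c"
  proof (rule choice_function.exchange_convex[OF choice_F[OF f]
        stable_acc(2)[OF st(1) f] stable_acc(2)[OF st(2) f] stable_acc(2)[OF st(3) f]])
    show "xf ?f x \<le> clF ?f (xf ?f x')" "xf ?f x' \<le> clF ?f (xf ?f x'')"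
      "sum (xf ?f x') (Ef G ?f) = sum (xf ?f x'') (Ef G ?f)"
      using b f by (simp_all add: belowD sum_rs)
    show "interesting (cap G) (Ef G ?f) (CF G ?f) (xf ?f x) a" 
      "interesting (cap G) (Ef G ?f) (CF G ?f) (xf ?f x'') a"
      using legal_f_facts(1)[OF l(1)] legal_f_facts(1)[OF l(2)] by (simp_all add: Uplus_iff)
    show "c \<in> Ef G ?f" "c \<noteq> a" using facts by (auto simp: Ef_def)
    show "gapless (cap G) (Ef G ?f) (CF G ?f)" using gl f by (simp add: all_gapless_def)
  qed (use l in \<open>simp_all add: legal_f_def\<close>)
  then show ?thesis using l a by (simp add: legal_f_def)
qed

lemma essential_w_convex:
  assumes gl: "all_gapless G" and st: "stable G x" "stable G x'" "stable G x''"
    and b: "below x x'" "below x' x''" and l: "essential_w G x c a" "essential_w G x'' c a"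
  shows "essential_w G x' c a"
proof -
  let ?w = "fst c"
  note facts = essential_w_facts[OF l(1)] and facts'' = essential_w_facts[OF l(2)]
  have w: "?w \<in> Wset G" using facts edge_ends by simp
  note UU = Uplus_antimono[OF st(1,2) b(1)] Uplus_antimono[OF st(2,3) b(2)]
  have a: "a \<in> U x'" using facts''(1) UU by auto
  have cn: "c \<notin> U x" using facts(3) by (auto simp: Uminus_def Uplus_def)
  \<comment> \<open>Values only decrease off \<open>U x\<close>, so positivity of \<open>c\<close>
    at \<open>x''\<close> forces it at \<open>x'\<close>.\<close>
  have "x'' c \<le> x' c" using cn UU belowD(2)[OF b(2)] by blast
  then have c': "c \<in> Uminus G x'"
    using facts''(3) facts(4) cn UU by (auto simp: Uminus_def Uplus_def)
  have "CW G ?w (offerW (U x' \<inter> Ew G ?w) (xw ?w x') - unitv c) = xw ?w x' + unitv a - unitv c"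
  proof (rule choice_function.essential_convex[OF choice_W[OF w]
        stable_acc(1)[OF st(1) w] stable_acc(1)[OF st(2) w] stable_acc(1)[OF st(3) w],
          where U = "U x \<inter> Ew G ?w" and U'' = "U x'' \<inter> Ew G ?w"])
    show "xw ?w x' e \<le> xw ?w x e" if "e \<notin> U x \<inter> Ew G ?w" for e
      using that belowD(2)[OF b(1), of e] by (auto simp: rs_def)
    show "xw ?w x'' e \<le> xw ?w x' e" if "e \<notin> U x' \<inter> Ew G ?w" for e
      using that belowD(2)[OF b(2), of e] by (auto simp: rs_def)
    show "sum (xw ?w x') (Ew G ?w) = sum (xw ?w x'') (Ew G ?w)"
      using belowD(3)[OF b(2)] by (simp add: sum_rs)
    show "c \<in> Ew G ?w" "c \<notin> U x \<inter> Ew G ?w" "0 < xw ?w x'' c" "a \<in> U x'' \<inter> Ew G ?w"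
      using facts facts'' cn by (auto simp: Ew_def rs_def Uminus_def)
    show "gapless (cap G) (Ew G ?w) (CW G ?w)" using gl w by (simp add: all_gapless_def)
  qed (use UU l facts facts'' st in \<open>auto simp: Uplus_not_interesting_W essential_w_iff[symmetric]\<close>)
  then show ?thesis using essential_w_iff[OF st(2) c' a facts(5)] by simp
qed

lemma active_convex:
  assumes "all_gapless G" "stable G x" "stable G x'" "stable G x''"
    and "below x x'" "below x' x''" and "active G x p" "active G x'' p"
  shows "active G x' p"
  using assms legal_f_convex[OF assms(1-6)] essential_w_convex[OF assms(1-6)]
  by (auto simp: active_def split: sum.splits)

section \<open>Shifting along a cycle\<close>

lemma card_rotation:
  assumes "active_cycle G x R"
  shows "card (fst ` set R \<inter> Ef G f) = card (snd ` set R \<inter> Ef G f)"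
    and "card (fst ` set R \<inter> Ew G w) = card (snd ` set R \<inter> Ew G w)"
proof -
  have R: "distinct (map fst R)" "distinct (map snd R)"
    using assms by (simp_all add: active_cycle_def)
  have "fst p \<in> Ef G f \<longleftrightarrow> snd p \<in> Ef G f" if "p \<in> set R" for p
    using legal_f_facts[OF active_cycleD(1)[OF assms, of "fst p" "snd p"]] that by (simp add: Ef_def)
  then show "card (fst ` set R \<inter> Ef G f) = card (snd ` set R \<inter> Ef G f)"
    using R by (intro card_fst_eq_snd) (simp_all add: distinct_map)
  have "map fst (w_pairs R) = map snd R" "map snd (w_pairs R) = rotate1 (map fst R)"
    by (simp_all add: w_pairs_def)
  then have "inj_on fst (set (w_pairs R))" "inj_on snd (set (w_pairs R))"
    using R by (metis distinct_map, metis distinct_map distinct1_rotate)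
  moreover have "fst p \<in> Ew G w \<longleftrightarrow> snd p \<in> Ew G w" if "p \<in> set (w_pairs R)" for p
    using essential_w_facts[OF active_cycleD(2)[OF assms, of "fst p" "snd p"]] that by (simp add: Ew_def)
  ultimately have "card (fst ` set (w_pairs R) \<inter> Ew G w) = card (snd ` set (w_pairs R) \<inter> Ew G w)"
    by (intro card_fst_eq_snd)
  then show "card (fst ` set R \<inter> Ew G w) = card (snd ` set R \<inter> Ew G w)"
    by (simp add: fst_w_pairs snd_w_pairs)
qed

lemma sum_chi:
  assumes "active_cycle G x R" "finite S" "card (fst ` set R \<inter> S) = card (snd ` set R \<inter> S)"
  shows "sum (chi R) S = 0"
proof -
  have "sum (chi R) S = (\<Sum>e\<in>S. (if e \<in> fst ` set R then 1 else 0) - (if e \<in> snd ` set R then 1 else 0))"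
    using assms(1) by (intro sum.cong) (auto simp: chi_def active_cycle_def)
  also have "\<dots> = int (card (S \<inter> fst ` set R)) - int (card (S \<inter> snd ` set R))"
    using assms(2) by (simp add: sum_subtractf sum.If_cases Int_def)
  finally show ?thesis using assms(3) by (simp add: Int_commute)
qed

lemma addrot_below:
  assumes st: "stable G x" "stable G (addrot x l R)" and R: "active_cycle G x R"
  shows "below x (addrot x l R)"
proof -
  let ?y = "addrot x l R"
  have fin: "finite (Ew G w)" "finite (Ef G f)" for w f
    using finite_E by (simp_all add: Ew_def Ef_def)
  have dec: "?y e \<le> x e" if "e \<notin> U x" for e
  proof -
    have "e \<notin> fst ` set R" using that active_cycleD(1)[OF R] legal_f_facts(1) by fastforce
    then show ?thesis by (auto simp: addrot_def chi_def)
  qed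
  \<comment> \<open>On \<open>U x\<close> the worker's closure is at capacity by stability;
    elsewhere the shift only lowers values.\<close>
  have W: "xw w ?y \<le> clW w (xw w x)" if w: "w \<in> Wset G" for w
  proof (rule le_funI)
    fix e
    show "xw w ?y e \<le> clW w (xw w x) e"
    proof (cases "e \<in> U x \<inter> Ew G w")
      case True
      then have "clW w (xw w x) e = cap G e"
        using Uplus_not_interesting_W[OF st(1) True] by (simp add: choice_function.cl_def[OF choice_W[OF w]])
      then show ?thesis using True stable_bounds[OF st(2), of e] by (auto simp: rs_def Ew_def)
    next
      case False
      then have "xw w ?y e \<le> xw w x e" using dec[of e] by (auto simp: rs_def)
      also have "\<dots> \<le> clW w (xw w x) e"
        using choice_function.le_cl[OF choice_W[OF w], of "xw w x", THEN le_funD, of e] stable_acc(1)[OF st(1) w]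
        by (simp add: acceptable_def)
      finally show ?thesis .
    qed
  qed
  text \<open>Polarity: the firms gain because the workers lose.\<close>
  have F: "xf f x \<le> clF f (xf f ?y)" if f: "f \<in> Fset G" for f
  proof (rule le_funI, rule ccontr)
    fix e assume less: "\<not> xf f x e \<le> clF f (xf f ?y) e"
    have xB: "xf f x \<in> Bv (cap G) (Ef G f)" using stable_acc(2)[OF st(1) f] by (simp add: acceptable_def)
    have eE: "e \<in> Ef G f"
      using less by (auto simp: choice_function.cl_def[OF choice_F[OF f]] rs_def split: if_splits)
    then have i: "interesting (cap G) (Ef G f) (CF G f) (xf f ?y) e" and lt: "?y e < x e"
      using less xB by (auto simp: choice_function.cl_def[OF choice_F[OF f]] rs_def Bv_def split: if_splits)
    have e: "e \<in> E" "snd e = f" using eE by (auto simp: Ef_def)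
    note w = edge_ends(1)[OF e(1)]
    \<comment> \<open>Having lost units, \<open>e\<close> also interests its worker at
      \<open>?y\<close>, so it would block.\<close>
    have "interesting (cap G) (Ew G (fst e)) (CW G (fst e)) (xw (fst e) ?y) e"
      using choice_function.interesting_if_less[OF choice_W[OF w] stable_acc(1)[OF st(1) w] stable_acc(1)[OF st(2) w] W[OF w], of e]
        lt e by (simp add: rs_def Ew_def)
    then show False
      using st(2) e i by (auto simp: stable_def blocks_def intW_def intF_def)
  qed
  have "sum ?y S = sum x S + int l * sum (chi R) S" for S
    by (simp add: addrot_def sum.distrib sum_distrib_left)
  then show ?thesis
    unfolding below_def using F dec sum_chi[OF R] fin card_rotation[OF R] by simp
qed

text \<open>All exchanges at a vertex can be made jointly: firms choose after gaining a unit on each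
  raised edge, workers after the offer loses a unit on each lowered edge. Both sides arrive at the
  same shifted vector.\<close>

lemma add_cycle_stable:
  assumes st: "stable G x" and R: "active_cycle G x R"
  shows "stable G (addrot x 1 R)"
proof -
  let ?y = "addrot x 1 R"
  let ?A = "fst ` set R" and ?D = "snd ` set R"
  have AD: "?A \<inter> ?D = {}" using R by (simp add: active_cycle_def)
  have A: "a \<in> U x" "a \<in> E" if "a \<in> ?A" for a
    using that active_cycleD(1)[OF R] legal_f_facts by fastforce+
  have D: "c \<in> Uminus G x" "c \<in> E" if "c \<in> ?D" for c
    using that active_cycleD(2)[OF R] essential_w_facts unfolding fst_w_pairs[symmetric] by fastforce+
  have y: "rs S ?y = (\<lambda>e. rs S x e + (if e \<in> ?A \<inter> S then 1 else if e \<in> ?D \<inter> S then -1 else 0))" for S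
    by (auto simp: rs_def addrot_def chi_def)
  have F: "acceptable (cap G) (Ef G f) (CF G f) (xf f ?y) \<and> xf f x \<le> clF f (xf f ?y)"
    if f: "f \<in> Fset G" for f
  proof -
    let ?u = "\<lambda>e. xf f x e + (if e \<in> ?A \<inter> Ef G f then 1 else 0)"
    have cover: "\<exists>a\<in>?A \<inter> Ef G f. CF G f (xf f x + unitv a) = xf f x + unitv a - unitv c"
      if c: "c \<in> ?D \<inter> Ef G f" for c
    proof -
      obtain a where a: "(a, c) \<in> set R" using c by auto
      note l = active_cycleD(1)[OF R a]
      have "a \<in> ?A \<inter> Ef G f" using a c legal_f_facts[OF l] by (force simp: Ef_def)
      then show ?thesis using l by (intro bexI[of _ a]) (auto simp: legal_f_def Ef_def)
    qed
    have intr: "interesting (cap G) (Ef G f) (CF G f) (xf f x) a" if "a \<in> ?A \<inter> Ef G f" for a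
      using A[of a] that by (auto simp: Uplus_iff Ef_def)
    have fin: "finite (?A \<inter> Ef G f)" "finite (?D \<inter> Ef G f)" by simp_all
    have disj: "?D \<inter> Ef G f \<subseteq> Ef G f" "?A \<inter> Ef G f \<inter> (?D \<inter> Ef G f) = {}" using AD by auto
    have u: "?u \<in> Bv (cap G) (Ef G f)" "CF G f ?u = xf f ?y"
      unfolding y
      by (rule choice_function.C_add_units[OF choice_F[OF f] stable_acc(2)[OF st f]
          fin(1) _ fin(2) disj _ card_rotation(1)[OF R]]; erule intr cover)+
    have acc: "acceptable (cap G) (Ef G f) (CF G f) (xf f ?y)"
      using choice_function.acc_C[OF choice_F[OF f] u(1)] u(2) by simp
    moreover have "xf f x \<le> clF f (xf f ?y)"
      by (rule choice_function.le_clI[OF choice_F[OF f] acc u])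
        (use stable_acc(2)[OF st f] in \<open>auto simp: acceptable_def le_fun_def\<close>)
    ultimately show ?thesis by simp
  qed
  let ?q = "\<lambda>w e. offerW (U x \<inter> Ew G w) (xw w x) e - (if e \<in> ?D \<inter> Ew G w then 1 else 0)"
  have W: "?q w \<in> Bv (cap G) (Ew G w) \<and> CW G w (?q w) = xw w ?y" if w: "w \<in> Wset G" for w
  proof -
    have cover: "\<exists>c\<in>?D \<inter> Ew G w. CW G w (offerW (U x \<inter> Ew G w) (xw w x) - unitv c) = xw w x + unitv a - unitv c"
      if a: "a \<in> ?A \<inter> Ew G w" for a
    proof -
      obtain c where c: "(c, a) \<in> set (w_pairs R)" using a unfolding snd_w_pairs[symmetric] by auto
      note l = active_cycleD(2)[OF R c] and facts = essential_w_facts[OF active_cycleD(2)[OF R c]]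
      have "c \<in> ?D \<inter> Ew G w" using a c facts unfolding fst_w_pairs[symmetric] by (force simp: Ew_def)
      then show ?thesis
        using l essential_w_iff[OF st facts(3,1,5)] a facts(5) by (intro bexI[of _ c]) (auto simp: Ew_def)
    qed
    have pos: "0 < xw w x c" and notU: "c \<notin> U x" if "c \<in> ?D \<inter> Ew G w" for c
      using that D[of c] by (auto simp: Uminus_def Uplus_def rs_def)
    have sub: "U x \<inter> Ew G w \<subseteq> Ew G w" "?D \<inter> Ew G w \<subseteq> Ew G w" "?A \<inter> Ew G w \<subseteq> U x \<inter> Ew G w"
      "?D \<inter> Ew G w \<inter> (U x \<inter> Ew G w) = {}" using A notU by blast+
    have fin: "finite (?A \<inter> Ew G w)" "finite (?D \<inter> Ew G w)" by simp_all
    show ?thesis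
      unfolding y
      by (intro conjI; rule choice_function.C_offer_diffs[OF choice_W[OF w] stable_acc(1)[OF st w] sub(1)
          _ fin(2) sub(2,4) _ sub(3) fin(1) _ card_rotation(2)[OF R]];
          erule Uplus_not_interesting_W[OF st] pos cover)
  qed
  have accW: "acceptable (cap G) (Ew G w) (CW G w) (xw w ?y)" if w: "w \<in> Wset G" for w
    using choice_function.acc_C[OF choice_W[OF w], of "?q w"] W[OF w] by simp
  have bounds: "0 \<le> ?y e \<and> ?y e \<le> cap G e" if e: "e \<in> E" for e
  proof -
    have eE: "e \<in> Ew G (fst e)" using e by (simp add: Ew_def)
    then have "0 \<le> xw (fst e) ?y e \<and> xw (fst e) ?y e \<le> cap G e"
      using accW[OF edge_ends(1)[OF e]] unfolding acceptable_def Bv_def by blast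
    then show ?thesis using eE by (simp add: rs_def)
  qed
  have zero: "?y e = 0" if "e \<notin> E" for e
  proof -
    have "x e = 0" using st that unfolding stable_def gmatching_def by blast
    then show ?thesis using that A(2)[of e] D(2)[of e] by (auto simp: addrot_def chi_def)
  qed
  have "\<not> blocks G ?y e" if e: "e \<in> E" for e
  proof
    assume b: "blocks G ?y e"
    note f = edge_ends(2)[OF e] and w = edge_ends(1)[OF e]
    \<comment> \<open>An edge interesting to its firm after the shift was so before. It is therefore
      not lowered and is still offered to the worker at capacity, so the worker wants no more of
      it.\<close>
    have "e \<in> U x"
      using choice_function.interesting_antimono[OF choice_F[OF f], of "xf (snd e) ?y" "xf (snd e) x" e]
        F[OF f] stable_acc(2)[OF st f] b e by (auto simp: blocks_def intF_def Uplus_iff)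
    moreover have "e \<notin> ?D" using D[of e] \<open>e \<in> U x\<close> by (auto simp: Uminus_def Uplus_def)
    ultimately have "?q (fst e) e = cap G e"
      using e by (simp add: choice_function.offer_def[OF choice_W[OF w]] Ew_def)
    then show False
      using choice_function.not_interestingI[OF choice_W[OF w], of "?q (fst e)" "xw (fst e) ?y" e] W[OF w] b by (auto simp: blocks_def intW_def)
  qed
  then show ?thesis
    using F accW bounds zero by (simp add: stable_def gmatching_def)
qed

section \<open>Cycles determined by one arc, and maximal weights\<close>

lemma legal_f_unique: "legal_f G x a c \<Longrightarrow> legal_f G x a c' \<Longrightarrow> c = c'"
  by (rule unitv_inject) (auto simp: legal_f_def)

lemma essential_w_unique:
  assumes "stable G x" "essential_w G x c a" "essential_w G x c a'"
  shows "a = a'"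
proof (rule unitv_inject)
  note e = essential_w_facts[OF assms(2)] and e' = essential_w_facts[OF assms(3)]
  show "unitv a = unitv a'"
    using essential_w_iff[OF assms(1) e(3,1,5)] essential_w_iff[OF assms(1) e'(3,1,5)] assms(2,3) by simp
qed

text \<open>At one stable \<open>x\<close> successors are unique, so agreement on one arc propagates
  around both cycles.\<close>

lemma same_rot_if_common_arc:
  assumes st: "stable G x" and R: "active_cycle G x R" "active_cycle G x R'"
    and p: "p \<in> rot_arcs R" "p \<in> rot_arcs R'"
  shows "same_rot R R'"
proof -
  let ?n = "length R" and ?n' = "length R'"
  have n: "0 < ?n" "0 < ?n'" using R by (auto simp: active_cycle_def)
  have d: "distinct R" "distinct R'" using R by (auto simp: active_cycle_def distinct_map)
  have eq_if_fst: "R ! i = R' ! j" if "i < ?n" "j < ?n'" "fst (R ! i) = fst (R' ! j)" for i j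
  proof -
    have "(fst (R ! i), snd (R ! i)) \<in> set R" "(fst (R' ! j), snd (R' ! j)) \<in> set R'"
      using that(1,2) by (simp_all only: prod.collapse nth_mem)
    then show ?thesis
      using legal_f_unique active_cycleD(1)[OF R(1)] active_cycleD(1)[OF R(2)] that(3) by (metis prod.expand)
  qed
  have succ: "essential_w G x (snd (Q ! i)) (fst (Q ! (Suc i mod length Q)))"
    if "active_cycle G x Q" "i < length Q" for Q i
    using active_cycleD(2)[OF that(1)] w_pairs_nth[OF that(2)] that(2) by (metis length_w_pairs nth_mem)
  have step: "R ! (Suc i mod ?n) = R' ! (Suc j mod ?n')" if "i < ?n" "j < ?n'" "snd (R ! i) = snd (R' ! j)" for i j
    using eq_if_fst[of "Suc i mod ?n" "Suc j mod ?n'"] n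
      essential_w_unique[OF st succ[OF R(1) that(1)]] succ[OF R(2) that(2)] that(3) by simp
  obtain m m' where m: "m < ?n" "m' < ?n'" "R ! m = R' ! m'"
  proof (cases p)
    case (Inl q)
    then have "q \<in> set R" "q \<in> set R'" using p by (auto simp: rot_arcs_def)
    then show ?thesis using that by (metis in_set_conv_nth)
  next
    case (Inr q)
    then have "q \<in> set (w_pairs R)" "q \<in> set (w_pairs R')" using p by (auto simp: rot_arcs_def)
    then obtain i j where "i < ?n" "j < ?n'" "w_pairs R ! i = w_pairs R' ! j"
      by (metis in_set_conv_nth length_w_pairs)
    then show ?thesis using that[OF _ _ step[of i j]] n by (simp add: w_pairs_nth)
  qed
  have *: "R ! ((m + t) mod ?n) = R' ! ((m' + t) mod ?n')" for t
  proof (induction t)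
    case (Suc t)
    then show ?case using step[of "(m + t) mod ?n" "(m' + t) mod ?n'"] n by (simp add: mod_Suc_eq)
  qed (use m in simp)
  \<comment> \<open>A full turn of \<open>R\<close> returns to the common pair and the pairs of
    \<open>R'\<close> are distinct, so the length of \<open>R'\<close> divides that of
    \<open>R\<close>. The converse is symmetric.\<close>
  have "R' ! ((m' + ?n) mod ?n') = R' ! m'" using *[of ?n] m by simp
  then have "(m' + ?n) mod ?n' = m' mod ?n'" using d n m by (simp add: nth_eq_iff_index_eq)
  then have 1: "?n' dvd ?n" by (metis diff_add_inverse mod_eq_dvd_iff_nat le_add1)
  have "R ! ((m + ?n') mod ?n) = R ! m" using *[of ?n'] m by simp
  then have "(m + ?n') mod ?n = m mod ?n" using d(1) n m(1) by (simp add: nth_eq_iff_index_eq)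
  then have "?n dvd ?n'" by (metis diff_add_inverse mod_eq_dvd_iff_nat le_add1)
  with 1 have len: "?n = ?n'" by (rule dvd_antisym[symmetric])
  \<comment> \<open>The amount aligns position \<open>m\<close> of \<open>R\<close> with position
    \<open>m'\<close> of \<open>R'\<close>; adding \<open>?n\<close> keeps the subtraction within
    the naturals.\<close>
  have "rotate (m + (?n - m')) R = R'"
  proof (rule nth_equalityI)
    fix i assume i: "i < length (rotate (m + (?n - m')) R)"
    have "R ! ((m + (?n - m' + i)) mod ?n) = R' ! ((m' + (?n - m' + i)) mod ?n')" by (rule *)
    also have "m' + (?n - m' + i) = i + ?n" using m len by simp
    finally show "rotate (m + (?n - m')) R ! i = R' ! i"
      using i len by (simp add: nth_rotate add.assoc)
  qed (simp add: len)
  then show ?thesis by (auto simp: same_rot_def)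
qed

text \<open>A maximum under \<open>GREATEST\<close> requires bounded weights; the capacity of any
  one raised edge, here that of the first pair, is a bound.\<close>

lemma feasible_le_tau:
  assumes st: "stable G x" and R: "active_cycle G x R" and l: "feasible_weight G x R l"
  shows "l \<le> tau G x R"
  unfolding tau_def
proof (rule Greatest_le_nat[where P = "feasible_weight G x R", OF l])
  let ?a = "fst (hd R)"
  have a: "?a \<in> fst ` set R" using R by (auto simp: active_cycle_def)
  then have aE: "?a \<in> E" using active_cycleD(1)[OF R] legal_f_facts(2) by fastforce
  fix k assume k: "feasible_weight G x R k"
  then have "stable G (addrot x k R)" by (simp add: feasible_weight_def)
  then have "x ?a + int k \<le> cap G ?a"
    using stable_bounds[of "addrot x k R" ?a] aE a by (simp add: addrot_def chi_def)
  then show "k \<le> nat (cap G ?a)" using stable_bounds[OF st aE] by linarith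
qed

end

section \<open>Rotations do not recur, and are counted by their last activated arcs\<close>

theorem theorem7p1:
  fixes G :: "('w,'f) market"
    and N :: nat
    and xs :: "nat \<Rightarrow> (('w \<times> 'f) \<Rightarrow> int)"
    and Rs :: "nat \<Rightarrow> (('w \<times> 'f) \<times> ('w \<times> 'f)) list"
    and lam :: "nat \<Rightarrow> nat"
  assumes "wf_market G"
    and "Eset G \<noteq> {}"
    and "all_gapless G"
    and "non_excessive G N xs Rs lam"
  shows "(\<forall>i j. 1 \<le> i \<and> i < j \<and> j < N \<longrightarrow> \<not> same_rot (Rs i) (Rs j))
         \<and> N < 4 * card (Eset G) ^ 2 * card (Fset G) * card (Wset G)"
proof -
  interpret market_setting G by unfold_locales (rule assms(1))
  have st: "stable G (xs i)" if "1 \<le> i" "i \<le> N" for i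
    using assms(4) that by (simp add: non_excessive_def route_def)
  have cyc: "active_cycle G (xs i) (Rs i)" if "1 \<le> i" "i < N" for i
    using assms(4) that by (simp add: non_excessive_def route_def rotation_active_cycle)
  have feas: "feasible_weight G (xs i) (Rs i) (lam i)" if "1 \<le> i" "i < N" for i
    using assms(4) that by (simp add: non_excessive_def route_def)
  have next_x: "xs (Suc i) = addrot (xs i) (lam i) (Rs i)" if "1 \<le> i" "i < N" for i
    using assms(4) that by (simp add: non_excessive_def route_def)
  have "below (xs i) (xs j)" if "i \<le> j" "1 \<le> i" "j \<le> N" for i j
    using that
  proof (induction j rule: dec_induct)
    case base
    then show ?case using below_refl st by simp
  next
    case (step j)
    have "below (xs j) (xs (Suc j))"
      using addrot_below[of "xs j" "lam j" "Rs j"] st[of j] st[of "Suc j"] cyc[of j] next_x[of j] step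
      by simp
    then show ?case using step below_trans[of "xs i" "xs j" "xs (Suc j)"] st by simp
  qed
  then have convex: "active G (xs j) p"
    if "1 \<le> i" "i \<le> j" "j \<le> k" "k \<le> N" "active G (xs i) p" "active G (xs k) p" for i j k p
    using active_convex[OF assms(3) st st st, of i j k p] that by simp

  have once: "\<not> same_rot (Rs i) (Rs j)" if ij: "1 \<le> i" "i < j" "j < N" for i j
  proof
    assume same: "same_rot (Rs i) (Rs j)"
    have lam: "lam i = tau G (xs i) (Rs i)"
      using assms(4) ij same unfolding non_excessive_def by blast
    have arcs: "rot_arcs (Rs j) = rot_arcs (Rs i)" using rot_arcs_same_rot[OF same] .
    have "active G (xs (Suc i)) p" if "p \<in> rot_arcs (Rs i)" for p
      using convex[of i "Suc i" j p] cyc[of i] cyc[of j] ij that arcs by (simp add: active_cycle_def)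
    then have "active_cycle G (xs (Suc i)) (Rs i)"
      using cyc[of i] ij by (simp add: active_cycle_def)
    then have "stable G (addrot (xs (Suc i)) 1 (Rs i))"
      using add_cycle_stable st[of "Suc i"] ij by simp
    \<comment> \<open>One further unit after the weight \<open>lam i\<close> amounts to weight
      \<open>lam i + 1\<close> at \<open>xs i\<close>, exceeding the maximum.\<close>
    moreover have "addrot (xs (Suc i)) 1 (Rs i) = addrot (xs i) (Suc (lam i)) (Rs i)"
      using next_x[of i] ij by (auto simp: addrot_def algebra_simps)
    ultimately have "feasible_weight G (xs i) (Rs i) (Suc (lam i))"
      using feas[of i] ij by (auto simp: feasible_weight_def le_Suc_eq)
    then show False using feasible_le_tau[OF st cyc, of i] lam ij by fastforce
  qed

  \<comment> \<open>The first member of the route at which all arcs of the rotation are active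
    together.\<close>
  define s where "s i = (LEAST k. 1 \<le> k \<and> (\<forall>p\<in>rot_arcs (Rs i). active G (xs k) p))" for i
  have s: "1 \<le> s i" "s i \<le> i" "\<And>p. p \<in> rot_arcs (Rs i) \<Longrightarrow> active G (xs (s i)) p" if "1 \<le> i" "i < N" for i
  proof -
    have i: "1 \<le> i \<and> (\<forall>p\<in>rot_arcs (Rs i). active G (xs i) p)"
      using cyc[of i] that by (simp add: active_cycle_def)
    show "s i \<le> i" unfolding s_def using i by (rule Least_le)
    show "1 \<le> s i" "\<And>p. p \<in> rot_arcs (Rs i) \<Longrightarrow> active G (xs (s i)) p"
      unfolding s_def using LeastI[of "\<lambda>k. 1 \<le> k \<and> (\<forall>p\<in>rot_arcs (Rs i). active G (xs k) p)", OF i] by auto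
  qed
  \<comment> \<open>Minimality of \<open>s i\<close> leaves an arc inactive just before it; at the
    start of the route any arc serves. This arc becomes \<open>q i\<close>.\<close>
  have "\<exists>p\<in>rot_arcs (Rs i). s i = 1 \<or> \<not> active G (xs (s i - 1)) p" if i: "1 \<le> i" "i < N" for i
  proof (cases "s i = 1")
    case True
    have "rot_arcs (Rs i) \<noteq> {}" using cyc[OF i] by (auto simp: active_cycle_def rot_arcs_def)
    then show ?thesis using True by auto
  next
    case False
    then have "s i - 1 < s i" "1 \<le> s i - 1" using s(1)[OF i] by linarith+
    then show ?thesis using not_less_Least unfolding s_def[of i] by blast
  qed
  then obtain q where q: "\<And>i. 1 \<le> i \<Longrightarrow> i < N \<Longrightarrow> q i \<in> rot_arcs (Rs i)"
    "\<And>i. 1 \<le> i \<Longrightarrow> i < N \<Longrightarrow> s i = 1 \<or> \<not> active G (xs (s i - 1)) (q i)"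
    by metis
  have s_mono: "s j \<le> s i" if i: "1 \<le> i" "i < N" and j: "1 \<le> j" "j < N" and eq: "q i = q j" for i j
  proof (rule ccontr)
    assume "\<not> s j \<le> s i"
    \<comment> \<open>Were \<open>s i < s j\<close>, the common arc would be active at both, hence
      by convexity at \<open>s j - 1\<close>, against the choice of \<open>q j\<close>.\<close>
    then have "active G (xs (s j - 1)) (q j)"
      using convex[of "s i" "s j - 1" "s j" "q j"] s[OF i] s[OF j] q(1)[OF i] q(1)[OF j] eq i j by simp
    then show False using q(2)[OF j] \<open>\<not> s j \<le> s i\<close> s(1)[OF i] by simp
  qed
  have same: "same_rot (Rs i) (Rs j)"
    if i: "1 \<le> i" "i < N" and j: "1 \<le> j" "j < N" and eq: "q i = q j" for i j
  proof -
    have sij: "s j = s i" using s_mono[OF i j eq] s_mono[OF j i eq[symmetric]] by simp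
    \<comment> \<open>Both rotations are cycles at the same stable g-matching and share an
      arc.\<close>
    have "active_cycle G (xs (s i)) (Rs i)" "active_cycle G (xs (s i)) (Rs j)"
      using cyc[OF i] cyc[OF j] s(3)[OF i] s(3)[OF j] sij by (simp_all add: active_cycle_def)
    then show ?thesis
      using same_rot_if_common_arc[OF st, of "s i" "Rs i" "Rs j" "q i"] s[OF i] q(1)[OF i] q(1)[OF j] eq i by simp
  qed
  have "inj_on q {1..<N}"
  proof (rule inj_onI)
    fix i j assume "i \<in> {1..<N}" "j \<in> {1..<N}" "q i = q j"
    then show "i = j" using same[of i j] same[of j i] once[of i j] once[of j i] by (cases i j rule: linorder_cases) auto
  qed
  moreover have "q ` {1..<N} \<subseteq> (E \<times> E) <+> (E \<times> E)"
  proof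
    fix p assume "p \<in> q ` {1..<N}"
    then obtain i where i: "1 \<le> i" "i < N" "p = q i" by auto
    then have "active G (xs i) p" using q(1)[of i] cyc[of i] by (simp add: active_cycle_def)
    then show "p \<in> (E \<times> E) <+> (E \<times> E)"
      by (auto simp: active_def Plus_def image_iff dest: legal_f_facts essential_w_facts split: sum.splits)
  qed
  ultimately have "card {1..<N} \<le> card ((E \<times> E) <+> (E \<times> E))"
    using finite_E by (intro card_inj_on_le) auto
  \<comment> \<open>A route with \<open>N\<close> members uses \<open>N - 1\<close> rotations, which
    accounts for the \<open>+ 1\<close>.\<close>
  then have N: "N \<le> 2 * (card E)\<^sup>2 + 1"
    using finite_E by (simp add: card_Plus card_cartesian_product power2_eq_square)
  have "0 < card E" using assms(2) finite_E by (simp add: card_gt_0_iff)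
  moreover have "0 < card (Fset G)" "0 < card (Wset G)"
    using assms(1,2) edge_ends by (auto simp: card_gt_0_iff wf_market_def)
  ultimately have "1 \<le> (card E)\<^sup>2" "1 \<le> card (Fset G) * card (Wset G)" by simp_all
  \<comment> \<open>Since there is an edge, all factors are positive: doubling the coefficient
    absorbs the \<open>+ 1\<close>, and the vertex counts only enlarge the bound.\<close>
  then have "2 * (card E)\<^sup>2 + 1 < 4 * (card E)\<^sup>2" "4 * (card E)\<^sup>2 * 1 \<le> 4 * (card E)\<^sup>2 * (card (Fset G) * card (Wset G))"
    by (linarith, intro mult_le_mono2)
  then have "N < 4 * (card E)\<^sup>2 * (card (Fset G) * card (Wset G))" using N by linarith
  then show ?thesis using once by (simp only: mult.assoc) blast
qed

end
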